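(* Let $(D,\mu)\in\mathbf{DistNP}$ be a problem over a finite alphabet $\Sigma$. Then there exist a problem $(E,\nu)\in\mathbf{DistNP}$ over the binary alphabet $\{0,1\}$ and a CS-reduction $f$ from $D$ to $E$ whose size growth $\mathcal{S}_f$ is linear.
   Context: Decision problems $D=(\Sigma^\ast,D^+)$, $\Sigma$ finite; spherical ensembles $\mu=\{\mu_n\}$ of probability functions on $\Sigma^n$; $\mu^\ast_{|x|}(x)=\mu_{|x|}(\{y\in\Sigma^{|x|}:y<_{lex}x\})$; $\mathbf{DistNP}$: $(D,\mu)$ with $D\in\mathbf{NP}$ and $x\mapsto\mu^\ast_{|x|}(x)$ Ptime computable (approximable within $2^{-k}$ in time polynomial in $|x|,k$). A Ptime reduction $f$ from $D$ to $E$ is polynomial-time computable with $x\in D^+\iff f(x)\in E^+$; size-invariant: $|x_1|<|x_2|\iff|f(x_1)|<|f(x_2)|$, in which case $\mathcal{S}_f(n)=|f(x)|$ for $|x|=n$ (size growth). $\nu$ is the $f$-transfer of $\mu$ if $\nu_{|y|}(y)=\sum_{x\in f^{-1}(y)}\mu_{|x|}(x)$ when $|y|=|f(z)|$ for some $z$, and $\nu_{|y|}(y)=|\Sigma_E|^{-|y|}$ otherwise. A CS-reduction from $(D,\mu)$ to $(E,\nu)$ is a size-invariant Ptime reduction $f$ from $D$ to $E$ such that $\nu$ is the $f$-transfer of $\mu$. *)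

theory Defs
  imports Complex_Main "HOL-Computational_Algebra.Polynomial"
begin

section \<open>Multitape Turing machines\<close>

text \<open>
  Tapes are infinite in both directions, and cells are numbered relative to the head: the head
  always scans cell 0, and moving it renumbers the cells. Symbols and states are natural numbers;
  symbol 0 is the blank and state 0 is the initial state. The transition table is a \<^emph>\<open>finite\<close>
  partial function, so a machine has finitely many states and a finite tape alphabet; it halts
  when no table entry applies.
\<close>

type_synonym tape = "int \<Rightarrow> nat"

datatype move = Move_Left | Stay | Move_Right

datatype tm = TM (tapes: nat) (table: "nat \<times> nat list \<rightharpoonup> nat \<times> (nat \<times> move) list")

definition wf_tm :: "tm \<Rightarrow> bool" where
  "wf_tm M \<longleftrightarrow> finite (dom (table M)) \<and>
     (\<forall>q ss q' acts. table M (q, ss) = Some (q', acts) \<longrightarrow>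
        length ss = tapes M \<and> length acts = tapes M)"

fun shift :: "move \<Rightarrow> tape \<Rightarrow> tape" where
  "shift Move_Left t = (\<lambda>i. t (i - 1))"
| "shift Stay t = t"
| "shift Move_Right t = (\<lambda>i. t (i + 1))"

fun act :: "nat \<times> move \<Rightarrow> tape \<Rightarrow> tape" where
  "act (s, m) t = shift m (t(0 := s))"

type_synonym config = "nat \<times> tape list"

fun applicable :: "tm \<Rightarrow> config \<Rightarrow> (nat \<times> (nat \<times> move) list) option" where
  "applicable M (q, ts) = table M (q, map (\<lambda>t. t 0) ts)"

definition halted :: "tm \<Rightarrow> config \<Rightarrow> bool" where
  "halted M c \<longleftrightarrow> applicable M c = None"

definition step :: "tm \<Rightarrow> config \<Rightarrow> config" where
  "step M c = (case applicable M c of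
      None \<Rightarrow> c
    | Some (q', acts) \<Rightarrow> (q', map2 act acts (snd c)))"

definition word_tape :: "nat list \<Rightarrow> tape" where
  "word_tape w = (\<lambda>i. if 0 \<le> i \<and> nat i < length w then w ! nat i else 0)"

definition init :: "tm \<Rightarrow> nat list list \<Rightarrow> config" where
  "init M ws = (0, map word_tape ws @ replicate (tapes M - length ws) (\<lambda>_. 0))"

text \<open>The word that starts under the head and extends to the first blank.\<close>

definition tape_reads :: "tape \<Rightarrow> nat list \<Rightarrow> bool" where
  "tape_reads t w \<longleftrightarrow> 0 \<notin> set w \<and> (\<forall>i < length w. t (int i) = w ! i) \<and> t (int (length w)) = 0"

text \<open>
  Each argument comes on a tape of its own. The result is read off the last tape, which is never
  an input tape. A halted configuration is a fixed point of \<^const>\<open>step\<close>, so halting after exactly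
  \<open>T\<close> iterations means halting within \<open>T\<close> steps.
\<close>

definition computes_within :: "tm \<Rightarrow> nat \<Rightarrow> nat list list \<Rightarrow> nat list \<Rightarrow> bool" where
  "computes_within M T ws out \<longleftrightarrow> length ws < tapes M \<and>
     (let c = (step M ^^ T) (init M ws) in halted M c \<and> tape_reads (last (snd c)) out)"


section \<open>Polynomial time\<close>

text \<open>
  A finite alphabet is a finite type; its linear order is the one underlying the lexicographic
  order on words. The \<open>i\<close>-th letter is represented by the tape symbol \<open>i\<close>, counting from 1.
\<close>

definition code :: "'a::{finite,linorder} \<Rightarrow> nat" where
  "code a = card {b. b \<le> a}"

abbreviation enc :: "'a::{finite,linorder} list \<Rightarrow> nat list" where
  "enc \<equiv> map code"

definition ptime :: "('a::{finite,linorder} list \<Rightarrow> 'b::{finite,linorder} list) \<Rightarrow> bool" where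
  "ptime f \<longleftrightarrow> (\<exists>M (p :: nat poly). wf_tm M \<and>
     (\<forall>x. computes_within M (poly p (length x)) [enc x] (enc (f x))))"

definition ptime2 ::
  "('a::{finite,linorder} list \<Rightarrow> 'b::{finite,linorder} list \<Rightarrow> 'c::{finite,linorder} list) \<Rightarrow> bool"
where
  "ptime2 g \<longleftrightarrow> (\<exists>M (p :: nat poly). wf_tm M \<and>
     (\<forall>x y. computes_within M (poly p (length x + length y)) [enc x, enc y] (enc (g x y))))"

text \<open>
  A decision problem over \<open>'a\<close> has all words as instances, hence is given by its set of positive
  instances.
\<close>

definition NP :: "'a::{finite,linorder} list set set" where
  "NP = {D. \<exists>(V :: 'a list \<Rightarrow> bool list \<Rightarrow> bool) (p :: nat poly).
     ptime2 (\<lambda>x w. [V x w]) \<and>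
     (\<forall>x. x \<in> D \<longleftrightarrow> (\<exists>w. length w \<le> poly p (length x) \<and> V x w))}"

text \<open>Binary expansions with the units digit first; they cover the dyadic rationals in $[0,2)$.\<close>

definition bin_frac :: "bool list \<Rightarrow> real" where
  "bin_frac bs = (\<Sum>i<length bs. of_bool (bs ! i) / 2 ^ i)"

text \<open>
  Approximability of a $[0,1]$-valued function within $2^{-k}$, in time polynomial in $|x|$ and $k$:
  the precision \<open>k\<close> is passed in unary, as a word of length \<open>k\<close> over a one-letter alphabet.
\<close>

definition ptime_real :: "('a::{finite,linorder} list \<Rightarrow> real) \<Rightarrow> bool" where
  "ptime_real r \<longleftrightarrow> (\<exists>g :: 'a list \<Rightarrow> unit list \<Rightarrow> bool list. ptime2 g \<and>
     (\<forall>x k. \<bar>bin_frac (g x (replicate k ())) - r x\<bar> \<le> 1 / 2 ^ k))"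


section \<open>Distributional problems\<close>

text \<open>The value \<open>\<mu> n x\<close> is meaningful only if \<open>x\<close> has length \<open>n\<close>.\<close>

type_synonym 'a ensemble = "nat \<Rightarrow> 'a list \<Rightarrow> real"

definition spherical_ensemble :: "'a::finite ensemble \<Rightarrow> bool" where
  "spherical_ensemble \<mu> \<longleftrightarrow>
     (\<forall>n. (\<forall>x. length x = n \<longrightarrow> 0 \<le> \<mu> n x) \<and> (\<Sum>x | length x = n. \<mu> n x) = 1)"

definition lex_less :: "'a::linorder list \<Rightarrow> 'a list \<Rightarrow> bool" where
  "lex_less y x \<longleftrightarrow> (y, x) \<in> lexord {(a, b). a < b}"

definition cumulative :: "'a::{finite,linorder} ensemble \<Rightarrow> 'a list \<Rightarrow> real" where
  "cumulative \<mu> x = (\<Sum>y | length y = length x \<and> lex_less y x. \<mu> (length x) y)"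

definition DistNP :: "('a::{finite,linorder} list set \<times> 'a ensemble) set" where
  "DistNP = {(D, \<mu>). spherical_ensemble \<mu> \<and> D \<in> NP \<and> ptime_real (cumulative \<mu>)}"


section \<open>Reductions\<close>

definition ptime_reduction ::
  "('a::{finite,linorder} list \<Rightarrow> 'b::{finite,linorder} list) \<Rightarrow> 'a list set \<Rightarrow> 'b list set \<Rightarrow> bool"
where
  "ptime_reduction f D E \<longleftrightarrow> ptime f \<and> (\<forall>x. x \<in> D \<longleftrightarrow> f x \<in> E)"

definition size_invariant :: "('a list \<Rightarrow> 'b list) \<Rightarrow> bool" where
  "size_invariant f \<longleftrightarrow>
     (\<forall>x\<^sub>1 x\<^sub>2. length x\<^sub>1 < length x\<^sub>2 \<longleftrightarrow> length (f x\<^sub>1) < length (f x\<^sub>2))"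

definition size_growth :: "('a list \<Rightarrow> 'b list) \<Rightarrow> nat \<Rightarrow> nat" where
  "size_growth f n = (THE m. \<forall>x. length x = n \<longrightarrow> length (f x) = m)"

lemma size_invariant_length_eq:
  assumes "size_invariant f"
  shows "length (f x) = length (f y) \<longleftrightarrow> length x = length y"
proof -
  have "length x < length y \<longleftrightarrow> length (f x) < length (f y)"
    and "length y < length x \<longleftrightarrow> length (f y) < length (f x)"
    using assms unfolding size_invariant_def by blast+
  then show ?thesis by linarith
qed

lemma size_growth_length:
  assumes "size_invariant f"
  shows "size_growth f (length x) = length (f x)"
  unfolding size_growth_def
proof (rule the_equality)
  show "\<forall>z. length z = length x \<longrightarrow> length (f z) = length (f x)"
    by (simp add: size_invariant_length_eq[OF assms])
qed simp

text \<open>The sum ranges over a finite set if \<open>f\<close> is size-invariant, by the lemma that follows.\<close>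

definition is_transfer ::
  "('a::finite list \<Rightarrow> 'b::finite list) \<Rightarrow> 'a ensemble \<Rightarrow> 'b ensemble \<Rightarrow> bool"
where
  "is_transfer f \<mu> \<nu> \<longleftrightarrow> (\<forall>y. \<nu> (length y) y =
     (if \<exists>z. length y = length (f z) then \<Sum>x | f x = y. \<mu> (length x) x
      else 1 / real (card (UNIV :: 'b set)) ^ length y))"

lemma finite_fibre:
  fixes f :: "'a::finite list \<Rightarrow> 'b list"
  assumes "size_invariant f"
  shows "finite {x. f x = y}"
proof (cases "\<exists>x. f x = y")
  case True
  then obtain x\<^sub>0 where "f x\<^sub>0 = y" by blast
  have "{x. f x = y} \<subseteq> {x. set x \<subseteq> UNIV \<and> length x = length x\<^sub>0}"
  proof (rule subsetI)
    fix x assume "x \<in> {x. f x = y}"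
    then have "length (f x) = length (f x\<^sub>0)"
      using \<open>f x\<^sub>0 = y\<close> by simp
    then have "length x = length x\<^sub>0"
      by (simp only: size_invariant_length_eq[OF assms])
    then show "x \<in> {x. set x \<subseteq> UNIV \<and> length x = length x\<^sub>0}"
      by simp
  qed
  moreover have "finite {x :: 'a list. set x \<subseteq> UNIV \<and> length x = length x\<^sub>0}"
    by (rule finite_lists_length_eq) (rule finite)
  ultimately show ?thesis
    by (rule finite_subset)
qed simp

definition CS_reduction ::
  "('a::{finite,linorder} list \<Rightarrow> 'b::{finite,linorder} list) \<Rightarrow>
    'a list set \<times> 'a ensemble \<Rightarrow> 'b list set \<times> 'b ensemble \<Rightarrow> bool"
where
  "CS_reduction f P Q \<longleftrightarrow>
     size_invariant f \<and> ptime_reduction f (fst P) (fst Q) \<and> is_transfer f (snd P) (snd Q)"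

end

(*
  Each letter is replaced by a block of L bits, where L is the size of the alphabet, monotonically
  for the lexicographic order. A word y whose length is a multiple of L is rounded up to the
  nearest code word, and the cumulative value of the transferred ensemble at y is that of the
  original ensemble at the decoded word. At the other lengths the transferred ensemble is uniform,
  and the cumulative value at y is the binary fraction 0.y. Decoding is done by a finite-state
  transducer, which can be put in front of any machine. For membership in NP the witnesses are
  stretched by a constant factor K, because the bound p(|y| / L) on their length need not be a
  polynomial with natural coefficients in |y|, while K * p(|y| / L) is one for a suitable K.
*)
theory Submission
  imports Defs "HOL-Library.Countable"
begin

section \<open>Machines over arbitrary state sets\<close>

text \<open>At a length divisible by L the transferred mass sits on code words only, so the
  cumulative value at y is the mass of the words whose code lies below y. As the code is monotone,
  these form an initial segment of the words of their length, and rounding y up finds its end even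
  when y is no code word. Whether L divides the length of y is known only after all of y has been
  read, while one machine must serve both cases; this is why the front end prepares two outcomes at
  once. Only two machines are written down with explicit tables, a block encoder and this front end.
  The front end hands over words no longer than its own inputs, so the time bound of the machine
  behind it survives up to a linear term. Blocks of length L instead of logarithmic length are
  affordable because the size growth only has to be linear.\<close>

type_synonym 's trans = "'s \<Rightarrow> nat list \<Rightarrow> ('s \<times> (nat \<times> move) list) option"

definition tstep :: "'s trans \<Rightarrow> 's \<times> tape list \<Rightarrow> 's \<times> tape list" where
  "tstep \<tau> c = (case \<tau> (fst c) (map (\<lambda>t. t 0) (snd c)) of
      None \<Rightarrow> c
    | Some (\<sigma>, acts) \<Rightarrow> (\<sigma>, map2 act acts (snd c)))"

text \<open>A bound in place of an exact step count lets estimates be added and weakened. Once the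
  machine has halted, idle steps fill up the rest, see \<open>reaches_halted\<close>.\<close>

definition reaches :: "'s trans \<Rightarrow> nat \<Rightarrow> 's \<times> tape list \<Rightarrow> 's \<times> tape list \<Rightarrow> bool" where
  "reaches \<tau> N c c' \<longleftrightarrow> (\<exists>n\<le>N. (tstep \<tau> ^^ n) c = c')"

lemma reaches_refl: "reaches \<tau> N c c"
  unfolding reaches_def by (rule exI[of _ 0]) simp

lemma reaches_trans:
  assumes "reaches \<tau> m a b" "reaches \<tau> n b c"
  shows "reaches \<tau> (m + n) a c"
proof -
  obtain i j where "i \<le> m" "(tstep \<tau> ^^ i) a = b" "j \<le> n" "(tstep \<tau> ^^ j) b = c"
    using assms unfolding reaches_def by blast
  then have "(tstep \<tau> ^^ (j + i)) a = c" "j + i \<le> m + n"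
    by (simp_all add: funpow_add)
  then show ?thesis unfolding reaches_def by blast
qed

lemma reaches_step: "tstep \<tau> a = b \<Longrightarrow> reaches \<tau> (Suc 0) a b"
  unfolding reaches_def by (rule exI[of _ 1]) simp

lemma reaches_Suc: "reaches \<tau> n (tstep \<tau> a) c \<Longrightarrow> reaches \<tau> (Suc n) a c"
  using reaches_trans[OF reaches_step[OF refl]] by fastforce

lemma reaches_mono: "reaches \<tau> m a b \<Longrightarrow> m \<le> n \<Longrightarrow> reaches \<tau> n a b"
  unfolding reaches_def using le_trans by blast

lemma reaches_halted:
  assumes "reaches \<tau> N a b" "tstep \<tau> b = b" "N \<le> T"
  shows "(tstep \<tau> ^^ T) a = b"
proof -
  obtain n where n: "n \<le> N" "(tstep \<tau> ^^ n) a = b"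
    using assms(1) unfolding reaches_def by blast
  have fix_b: "(tstep \<tau> ^^ k) b = b" for k
    by (induction k) (use assms(2) in simp_all)
  have "(tstep \<tau> ^^ (T - n + n)) a = b"
    unfolding funpow_add by (simp add: n fix_b)
  then show ?thesis using n(1) assms(3) by simp
qed

text \<open>\<open>Suc\<close> keeps 0 free for the initial state, in which every \<open>tm\<close>
  starts.\<close>

definition state_code :: "'s::countable \<Rightarrow> 's \<Rightarrow> nat" where
  "state_code \<sigma>\<^sub>0 \<sigma> = (if \<sigma> = \<sigma>\<^sub>0 then 0 else Suc (to_nat \<sigma>))"

lemma inj_state_code: "inj (state_code \<sigma>\<^sub>0)"
  by (auto simp: inj_def state_code_def)

lemma state_code_initial [simp]: "state_code \<sigma>\<^sub>0 \<sigma>\<^sub>0 = 0"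
  by (simp add: state_code_def)

text \<open>\<open>inv\<close> is arbitrary outside the range of \<open>state_code\<close>. Without
  the range test infinitely many numbers could inherit a transition, and the table would not be
  finite.\<close>

definition machine :: "nat \<Rightarrow> 's::countable \<Rightarrow> 's trans \<Rightarrow> tm" where
  "machine k \<sigma>\<^sub>0 \<tau> = TM k (\<lambda>(q, ss).
     if q \<in> range (state_code \<sigma>\<^sub>0)
     then map_option (apfst (state_code \<sigma>\<^sub>0)) (\<tau> (inv (state_code \<sigma>\<^sub>0) q) ss) else None)"

lemma tapes_machine [simp]: "tapes (machine k \<sigma>\<^sub>0 \<tau>) = k"
  by (simp add: machine_def)

lemma table_machine:
  "table (machine k \<sigma>\<^sub>0 \<tau>) (state_code \<sigma>\<^sub>0 \<sigma>, ss) = map_option (apfst (state_code \<sigma>\<^sub>0)) (\<tau> \<sigma> ss)"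
  by (simp add: machine_def inv_f_f[OF inj_state_code])

lemma wf_machine:
  assumes fin: "finite {(\<sigma>, ss). \<tau> \<sigma> ss \<noteq> None}"
    and len: "\<And>\<sigma> ss \<sigma>' acts. \<tau> \<sigma> ss = Some (\<sigma>', acts) \<Longrightarrow> length ss = k \<and> length acts = k"
  shows "wf_tm (machine k \<sigma>\<^sub>0 \<tau>)"
proof -
  have "dom (table (machine k \<sigma>\<^sub>0 \<tau>)) \<subseteq> apfst (state_code \<sigma>\<^sub>0) ` {(\<sigma>, ss). \<tau> \<sigma> ss \<noteq> None}"
  proof
    fix x assume x: "x \<in> dom (table (machine k \<sigma>\<^sub>0 \<tau>))"
    obtain q ss where [simp]: "x = (q, ss)" by (cases x)
    obtain \<sigma> where [simp]: "q = state_code \<sigma>\<^sub>0 \<sigma>"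
      using x by (auto simp: machine_def split: if_splits)
    have "\<tau> \<sigma> ss \<noteq> None" using x by (auto simp: table_machine)
    then show "x \<in> apfst (state_code \<sigma>\<^sub>0) ` {(\<sigma>, ss). \<tau> \<sigma> ss \<noteq> None}"
      by (intro image_eqI[of _ _ "(\<sigma>, ss)"]) auto
  qed
  then have "finite (dom (table (machine k \<sigma>\<^sub>0 \<tau>)))"
    using fin finite_surj by blast
  moreover have "length ss = k \<and> length acts = k"
    if "table (machine k \<sigma>\<^sub>0 \<tau>) (q, ss) = Some (q', acts)" for q ss q' acts
    using that by (auto simp: machine_def split: if_splits dest: len)
  ultimately show ?thesis by (simp add: wf_tm_def)
qed

lemma step_machine:
  "step (machine k \<sigma>\<^sub>0 \<tau>) (apfst (state_code \<sigma>\<^sub>0) c) = apfst (state_code \<sigma>\<^sub>0) (tstep \<tau> c)"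
  by (cases c) (auto simp: step_def tstep_def table_machine split: option.splits)

lemma steps_machine:
  "(step (machine k \<sigma>\<^sub>0 \<tau>) ^^ n) (apfst (state_code \<sigma>\<^sub>0) c)
     = apfst (state_code \<sigma>\<^sub>0) ((tstep \<tau> ^^ n) c)"
  by (induction n) (simp_all add: step_machine)

lemma computes_within_machineI:
  assumes "length ws < k"
    and "reaches \<tau> N (\<sigma>\<^sub>0, map word_tape ws @ replicate (k - length ws) (\<lambda>_. 0)) (\<sigma>, ts)"
    and halt: "\<tau> \<sigma> (map (\<lambda>t. t 0) ts) = None"
    and "tape_reads (last ts) out" "N \<le> T"
  shows "computes_within (machine k \<sigma>\<^sub>0 \<tau>) T ws out"
proof -
  have "tstep \<tau> (\<sigma>, ts) = (\<sigma>, ts)" by (simp add: tstep_def halt)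
  then have "(tstep \<tau> ^^ T) (\<sigma>\<^sub>0, map word_tape ws @ replicate (k - length ws) (\<lambda>_. 0)) = (\<sigma>, ts)"
    using reaches_halted assms(2,5) by blast
  then have "(step (machine k \<sigma>\<^sub>0 \<tau>) ^^ T) (init (machine k \<sigma>\<^sub>0 \<tau>) ws) = (state_code \<sigma>\<^sub>0 \<sigma>, ts)"
    using steps_machine[where k = k and \<tau> = \<tau> and \<sigma>\<^sub>0 = \<sigma>\<^sub>0 and n = T and c
      = "(\<sigma>\<^sub>0, map word_tape ws @ replicate (k - length ws) (\<lambda>_. 0))"]
    by (simp add: init_def)
  then show ?thesis
    using assms(1,4) by (simp add: computes_within_def halted_def table_machine halt)
qed

text \<open>A \<open>tm\<close> is itself a transition function with state set \<open>nat\<close>,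
  so the facts on \<open>reaches\<close> also apply to a machine that is merely given.\<close>

lemma step_eq_tstep: "step M = tstep (curry (table M))"
  by (rule ext) (auto simp: step_def tstep_def split: option.splits)

lemma computes_within_mono:
  assumes "computes_within M T ws out" "T \<le> T'"
  shows "computes_within M T' ws out"
proof -
  let ?c = "(step M ^^ T) (init M ws)"
  have "halted M ?c" using assms(1) by (simp add: computes_within_def Let_def)
  then have "step M ?c = ?c" by (simp add: halted_def step_def)
  then have "(step M ^^ T') (init M ws) = ?c"
    unfolding step_eq_tstep by (intro reaches_halted[OF _ _ assms(2)]) (auto simp: reaches_def)
  with assms(1) show ?thesis by (simp add: computes_within_def)
qed

text \<open>\<open>map2\<close> truncates to the shorter list; well-formedness prevents the loss of
  tapes, in particular of the last one, which carries the result.\<close>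

lemma length_tapes_tstep:
  assumes "wf_tm M" "length (snd c) = tapes M"
  shows "length (snd ((tstep (curry (table M)) ^^ n) c)) = tapes M"
proof (induction n)
  case (Suc n)
  then show ?case
    using assms(1) by (force simp: tstep_def wf_tm_def split: option.splits prod.splits)
qed (simp add: assms(2))

lemma computes_withinE:
  assumes "computes_within M T ws out" "wf_tm M"
  obtains q ts where
    "reaches (curry (table M)) T (0, map word_tape ws @ replicate
      (tapes M - length ws) (\<lambda>_. 0)) (q, ts)"
    "table M (q, map (\<lambda>t. t 0) ts) = None" "tape_reads (last ts) out" "length ts = tapes M"
proof -
  let ?c = "(0, map word_tape ws @ replicate (tapes M - length ws) (\<lambda>_. 0))"
  obtain q ts where c: "(tstep (curry (table M)) ^^ T) ?c = (q, ts)" by fastforce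
  have "length (snd ((tstep (curry (table M)) ^^ T) ?c)) = tapes M"
    using assms by (intro length_tapes_tstep) (auto simp: computes_within_def)
  then show thesis
    using assms(1) c that[of q ts]
    by (auto simp: computes_within_def halted_def reaches_def step_eq_tstep init_def Let_def)
qed

section \<open>Tapes as pairs of words\<close>

text \<open>\<open>l\<close> is read leftwards from cell \<open>-1\<close>, \<open>r\<close> rightwards from cell \<open>0\<close>.\<close>

definition tape_of :: "nat list \<Rightarrow> nat list \<Rightarrow> tape" where
  "tape_of l r = (\<lambda>i. if 0 \<le> i then (if nat i < length r then r ! nat i else 0)
                     else (if nat (- i - 1) < length l then l ! nat (- i - 1) else 0))"

text \<open>The head stands one cell to the left of \<open>r\<close>, hence on the first letter of
  \<open>l\<close>. When a word without blanks is rewound, a scanned blank thus signals its left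
  end.\<close>

definition tape_before :: "nat list \<Rightarrow> nat list \<Rightarrow> tape" where
  "tape_before l r = shift Move_Left (tape_of l r)"

lemma word_tape_eq: "word_tape w = tape_of [] w"
  by (auto simp: word_tape_def tape_of_def)

lemma blank_tape_eq: "(\<lambda>_. 0) = tape_of [] []"
  by (auto simp: tape_of_def)

lemma tape_of_scan [simp]: "tape_of l [] 0 = 0" "tape_of l (a # r) 0 = a"
  by (simp_all add: tape_of_def)

lemma tape_before_scan [simp]: "tape_before [] r 0 = 0" "tape_before (a # l) r 0 = a"
  by (simp_all add: tape_before_def tape_of_def)

lemma act_stay [simp]: "act (t 0, Stay) t = t"
  by simp

lemma act_stay_blank: "t 0 = 0 \<Longrightarrow> act (0, Stay) t = t"
  by (metis act_stay)

lemma tape_of_nonneg: "tape_of l r (int n) = (if n < length r then r ! n else 0)"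
  by (simp add: tape_of_def)

lemma tape_of_neg: "tape_of l r (- 1 - int n) = (if n < length l then l ! n else 0)"
  by (simp add: tape_of_def)

lemma tape_of_neg': "tape_of l r (- int n - 1) = (if n < length l then l ! n else 0)"
  by (simp add: tape_of_def)

lemma tape_of_Suc: "tape_of l r (int n + 1) = (if Suc n < length r then r ! Suc n else 0)"
  using tape_of_nonneg[of l r "Suc n"] by (simp add: add.commute)

lemma tape_of_neg_Suc: "tape_of l r (- 2 - int n) = (if Suc n < length l then l ! Suc n else 0)"
  using tape_of_neg[of l r "Suc n"] by simp

lemma tape_eqI:
  assumes "\<And>n. s (int n) = t (int n)" "\<And>n. s (- 1 - int n) = t (- 1 - int n)"
  shows "s = (t :: tape)"
proof
  fix i
  show "s i = t i"
    using assms(1)[of "nat i"] assms(2)[of "nat (- 1 - i)"] by (cases "0 \<le> i") auto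
qed

lemma act_right: "act (b, Move_Right) (tape_of l r) = tape_of (b # l) (tl r)"
proof (rule tape_eqI)
  fix n
  show "act (b, Move_Right) (tape_of l r) (int n) = tape_of (b # l) (tl r) (int n)"
    by (auto simp: tape_of_nonneg tape_of_Suc nth_tl)
next
  fix n
  show "act (b, Move_Right) (tape_of l r) (- 1 - int n) = tape_of (b # l) (tl r) (- 1 - int n)"
  proof (cases n)
    case (Suc m)
    then have "- 1 - int n + 1 = - 1 - int m" by simp
    then show ?thesis by (simp only: act.simps shift.simps) (simp add: tape_of_neg tape_of_neg_Suc
      Suc)
  qed (simp add: tape_of_neg[of _ _ 0, simplified])
qed

lemma act_left_end: "act (0, Move_Left) (tape_of l []) = tape_before l []"
  by (auto simp: tape_before_def tape_of_def)

lemma act_before_left: "act (b, Move_Left) (tape_before (a # l) r) = tape_before l (b # r)"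
proof -
  \<comment> \<open>\<open>tape_before\<close> is \<open>tape_of\<close> shifted by one cell, so at
    arguments \<open>i + 1\<close> the case split of \<open>tape_eqI\<close> falls on the cut
    between the two words.\<close>
  have "act (b, Move_Left) (tape_before (a # l) r) (i + 1) = tape_before l (b # r) (i + 1)" for i
  proof (rule fun_cong[of _ _ i], rule tape_eqI)
    fix n
    show "act (b, Move_Left) (tape_before (a # l) r) (int n + 1)
      = tape_before l (b # r) (int n + 1)"
    proof (cases n)
      case (Suc m)
      then show ?thesis
        using tape_of_Suc[of l "b # r" m]
        by (simp add: tape_before_def tape_of_nonneg add.commute)
    qed (simp add: tape_before_def)
  next
    fix n
    show "act (b, Move_Left) (tape_before (a # l) r) (- 1 - int n + 1)
        = tape_before l (b # r) (- 1 - int n + 1)"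
      by (simp add: tape_before_def tape_of_neg_Suc tape_of_neg')
  qed
  from this[of "i - 1" for i] show ?thesis by (auto simp: fun_eq_iff)
qed

lemma act_before_erase: "act (0, Move_Left) (tape_before (a # l) []) = tape_before l []"
  unfolding act_before_left by (auto simp: tape_before_def tape_of_def)

lemma act_before_right: "act (0, Move_Right) (tape_before [] r) = tape_of [] r"
  by (auto simp: tape_before_def tape_of_def fun_eq_iff)

lemma tape_reads_tape_of: "0 \<notin> set w \<Longrightarrow> tape_reads (tape_of l w) w"
  by (simp add: tape_reads_def tape_of_def)

section \<open>Prefixing a machine with finite-state transducers\<close>

datatype 's phase = Start | Scan 's | Rewind bool | Done | Run nat

instance phase :: (countable) countable
  by countable_datatype

text \<open>Output 0 stands for no output.\<close>

fun mealy_out :: "('s \<Rightarrow> nat \<Rightarrow> 's \<times> nat) \<Rightarrow> 's \<Rightarrow> nat list \<Rightarrow> nat list" where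
  "mealy_out \<delta> p [] = []"
| "mealy_out \<delta> p (a # u) =
    (if snd (\<delta> p a) = 0 then [] else [snd (\<delta> p a)]) @ mealy_out \<delta> (fst (\<delta> p a)) u"

fun mealy_state :: "('s \<Rightarrow> nat \<Rightarrow> 's \<times> nat) \<Rightarrow> 's \<Rightarrow> nat list \<Rightarrow> 's" where
  "mealy_state \<delta> p [] = p"
| "mealy_state \<delta> p (a # u) = mealy_state \<delta> (fst (\<delta> p a)) u"

text \<open>State types such as \<open>bool list \<times> bool\<close> are infinite; a finite set
  \<open>P\<close> closed under the transitions keeps the machine table finite. Input symbols start
  at 1 because the blank marks the end of the input.\<close>

definition mealy_bounded :: "nat \<Rightarrow> 's set \<Rightarrow> ('s \<Rightarrow> nat \<Rightarrow> 's \<times> nat) \<Rightarrow> bool" where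
  "mealy_bounded B P \<delta> \<longleftrightarrow> finite P \<and> (\<forall>p\<in>P. \<forall>a\<in>{1..B}. \<delta> p a \<in> P \<times> {..B})"

lemma mealy_boundedD:
  assumes "mealy_bounded B P \<delta>" "p \<in> P" "set (a # u) \<subseteq> {1..B}"
  shows "fst (\<delta> p a) \<in> P" "snd (\<delta> p a) \<le> B"
proof -
  have "\<delta> p a \<in> P \<times> {..B}" using assms by (simp add: mealy_bounded_def)
  then show "fst (\<delta> p a) \<in> P" "snd (\<delta> p a) \<le> B" by (simp_all add: mem_Times_iff)
qed

lemma length_mealy_out: "length (mealy_out \<delta> p u) \<le> length u"
  by (induction u arbitrary: p) (simp_all add: le_SucI)

lemma mealy_out_symbols:
  assumes "mealy_bounded B P \<delta>" "p \<in> P" "set u \<subseteq> {1..B}"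
  shows "set (mealy_out \<delta> p u) \<subseteq> {1..B}"
  using assms(2,3)
proof (induction u arbitrary: p)
  case (Cons a u)
  then show ?case using mealy_boundedD[OF assms(1) Cons.prems] Cons.IH by auto
qed simp

lemma mealy_state_in:
  assumes "mealy_bounded B P \<delta>" "p \<in> P" "set u \<subseteq> {1..B}"
  shows "mealy_state \<delta> p u \<in> P"
  using assms(2,3)
proof (induction u arbitrary: p)
  case (Cons a u)
  then show ?case using mealy_boundedD[OF assms(1) Cons.prems] by auto
qed simp

definition emit :: "nat \<Rightarrow> nat \<times> move" where
  "emit a = (a, if a = 0 then Stay else Move_Right)"

text \<open>A blank stops the head, so words of different lengths can be rewound in parallel, the
  shorter ones waiting at their left end.\<close>

definition retreat :: "nat \<Rightarrow> nat \<times> move" where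
  "retreat a = (a, if a = 0 then Stay else Move_Left)"

definition erase :: "nat \<Rightarrow> nat \<times> move" where
  "erase a = (0, if a = 0 then Stay else Move_Left)"

lemma act_emit: "act (emit b) (tape_of l []) = tape_of ((if b = 0 then [] else [b]) @ l) []"
  using act_stay[of "tape_of l []"] by (simp add: emit_def act_right del: act.simps)

lemma act_retreat:
  assumes "0 \<notin> set l"
  shows "act (retreat (tape_before l r 0)) (tape_before l r) = tape_before (tl l) (take 1 l @ r)"
  using assms act_stay[of "tape_before [] r"]
  by (cases l) (simp_all add: retreat_def act_before_left del: act.simps)

lemma act_erase:
  assumes "0 \<notin> set l"
  shows "act (erase (tape_before l [] 0)) (tape_before l []) = tape_before (tl l) []"
  using assms act_stay[of "tape_before [] []"]
  by (cases l) (simp_all add: erase_def act_before_erase del: act.simps)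

text \<open>
  The two input tapes are followed by the tapes of \<open>M\<close>. The inputs are transduced onto the
  first two tapes of \<open>M\<close>. Whether \<open>M\<close> will run is known only when the first input has been read,
  so the alternative output is written to the last tape in any case, and erased if \<open>M\<close> runs.
\<close>

locale front_end =
  fixes M :: tm
    and \<delta>\<^sub>1 :: "'s::countable \<Rightarrow> nat \<Rightarrow> 's \<times> nat" and \<delta>\<^sub>2 :: "'t::countable \<Rightarrow> nat \<Rightarrow> 't \<times> nat"
    and P\<^sub>1 :: "'s set" and P\<^sub>2 :: "'t set" and p\<^sub>1 :: 's and p\<^sub>2 :: 't
    and acc :: "'s \<Rightarrow> bool" and copy :: bool and B :: nat
  assumes wf_M: "wf_tm M" and tapes_M: "2 < tapes M"
    and bounded: "mealy_bounded B P\<^sub>1 \<delta>\<^sub>1" "mealy_bounded B P\<^sub>2 \<delta>\<^sub>2"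
    and initial: "p\<^sub>1 \<in> P\<^sub>1" "p\<^sub>2 \<in> P\<^sub>2"
    and B_pos: "1 \<le> B"
begin

text \<open>Besides the two inputs only the first, second and last tape of \<open>M\<close> are
  touched. The 1 emitted at the start is \<open>code False\<close>, the first symbol of the
  alternative output.\<close>

fun front :: "('s \<times> 't) phase \<Rightarrow> nat \<Rightarrow> nat \<Rightarrow> nat \<Rightarrow> nat \<Rightarrow> nat \<Rightarrow>
    (('s \<times> 't) phase \<times> (nat \<times> move) \<times> (nat \<times> move) \<times> (nat \<times> move) \<times> (nat \<times> move) \<times> (nat \<times> move))
      option"
where
  "front Start s t a b c =
     Some (Scan (p\<^sub>1, p\<^sub>2), (s, Stay), (t, Stay), (a, Stay), (b, Stay), emit 1)"
| "front (Scan (p, p')) s t a b c =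
     (if p \<notin> P\<^sub>1 \<or> p' \<notin> P\<^sub>2 then None
      else if s \<noteq> 0 then Some (Scan (fst (\<delta>\<^sub>1 p s), p'), (s, Move_Right), (t, Stay),
        emit (snd (\<delta>\<^sub>1 p s)), (b, Stay), emit (if copy then s else 0))
      else if t \<noteq> 0 then Some (Scan (p, fst (\<delta>\<^sub>2 p' t)), (s, Stay), (t, Move_Right),
        (a, Stay), emit (snd (\<delta>\<^sub>2 p' t)), (c, Stay))
      else Some (Rewind (acc p), (s, Stay), (t, Stay), (0, Move_Left), (0, Move_Left), (0,
        Move_Left)))"
| "front (Rewind m) s t a b c =
     (if a = 0 \<and> b = 0 \<and> c = 0
      then Some (if m then Run 0 else Done, (s, Stay), (t, Stay),
        (0, Move_Right), (0, Move_Right), (0, Move_Right))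
      else Some (Rewind m, (s, Stay), (t, Stay), retreat a, retreat b,
        if m then erase c else retreat c))"
| "front _ s t a b c = None"

text \<open>While \<open>M\<close> runs, the input heads rest on the blanks behind the inputs.
  Demanding these blanks gives each table entry of \<open>M\<close> exactly one counterpart; in the
  other phases the bound \<open>B\<close> on the symbols ensures finiteness.\<close>

fun trans :: "('s \<times> 't) phase trans" where
  "trans (Run q) ss =
     (if take 2 ss = [0, 0]
      then map_option (\<lambda>(q', acts). (Run q', (0, Stay) # (0, Stay) # acts)) (table M (q, drop 2 ss))
      else None)"
| "trans \<sigma> ss =
     (if length ss = tapes M + 2 \<and> set ss \<subseteq> {..B}
      then map_option (\<lambda>(\<sigma>', x, y, u, v, w). (\<sigma>', [x, y, u, v] @ replicate
        (tapes M - 3) (0, Stay) @ [w]))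
        (front \<sigma> (ss ! 0) (ss ! 1) (ss ! 2) (ss ! 3) (last ss))
      else None)"

definition front_tm :: tm where
  "front_tm = machine (tapes M + 2) Start trans"

lemma wf_front_tm: "wf_tm front_tm"
  unfolding front_tm_def
proof (rule wf_machine)
  let ?F = "{Start, Rewind True, Rewind False} \<union> Scan ` (P\<^sub>1 \<times> P\<^sub>2)"
  let ?S = "{ss. set ss \<subseteq> {..B} \<and> length ss = tapes M + 2}"
  let ?R = "(\<lambda>(q, ss). (Run q, 0 # 0 # ss)) ` dom (table M) :: (('s \<times> 't) phase \<times> nat list) set"
  have "{(\<sigma>, ss). trans \<sigma> ss \<noteq> None} \<subseteq> ?F \<times> ?S \<union> ?R"
  proof
    fix z assume "z \<in> {(\<sigma>, ss). trans \<sigma> ss \<noteq> None}"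
    then obtain \<sigma> ss y where z: "z = (\<sigma>, ss)" and tr: "trans \<sigma> ss = Some y" by auto
    show "z \<in> ?F \<times> ?S \<union> ?R"
    proof (cases \<sigma>)
      case (Run q)
      with tr have "take 2 ss = [0, 0]" "(q, drop 2 ss) \<in> dom (table M)"
        by (auto split: if_splits)
      moreover from this have "ss = 0 # 0 # drop 2 ss"
        by (metis append_take_drop_id append_Cons append_Nil)
      ultimately have "(\<sigma>, ss) \<in> ?R" using Run by (auto intro!: image_eqI[of _ _ "(q, drop 2 ss)"])
      then show ?thesis using z by blast
    qed (use tr z in \<open>auto split: if_splits\<close>)
  qed
  moreover have "finite (?F \<times> ?S \<union> ?R)"
    using bounded wf_M finite_lists_length_eq[of "{..B}"]
    by (auto simp: mealy_bounded_def wf_tm_def intro!: finite_cartesian_product)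
  ultimately show "finite {(\<sigma>, ss). trans \<sigma> ss \<noteq> None}"
    by (rule finite_subset)
next
  fix \<sigma> ss \<sigma>' acts assume tr: "trans \<sigma> ss = Some (\<sigma>', acts)"
  show "length ss = tapes M + 2 \<and> length acts = tapes M + 2"
  proof (cases \<sigma>)
    case (Run q)
    then obtain q' as where *: "take 2 ss = [0, 0]" "table M (q, drop 2 ss) = Some (q', as)"
        "acts = (0, Stay) # (0, Stay) # as"
      using tr by (auto split: if_splits)
    then have "length (drop 2 ss) = tapes M" "length as = tapes M"
      using wf_M unfolding wf_tm_def by blast+
    moreover have "length (take 2 ss) = 2" using *(1) by simp
    ultimately show ?thesis using *(3) by simp
  qed (use tr tapes_M in \<open>auto split: if_splits\<close>)
qed

definition layout :: "tape \<Rightarrow> tape \<Rightarrow> tape \<Rightarrow> tape \<Rightarrow> tape \<Rightarrow> tape list" where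
  "layout x y u v w = [x, y, u, v] @ replicate (tapes M - 3) (\<lambda>_. 0) @ [w]"

lemma tstep_layout:
  assumes "front \<sigma> (x 0) (y 0) (u 0) (v 0) (w 0) = Some (\<sigma>', a, b, c, d, e)"
    and "{x 0, y 0, u 0, v 0, w 0} \<subseteq> {..B}"
  shows "tstep trans (\<sigma>, layout x y u v w)
    = (\<sigma>', layout (act a x) (act b y) (act c u) (act d v) (act e w))"
proof -
  have tr: "trans \<sigma> (map (\<lambda>t. t 0) (layout x y u v w))
      = Some (\<sigma>', [a, b, c, d] @ replicate (tapes M - 3) (0, Stay) @ [e])"
    using assms tapes_M by (cases \<sigma>) (auto simp: layout_def)
  have blank: "act (0, Stay) (\<lambda>_. 0) = (\<lambda>_. 0)" by auto
  then have "map2 act (replicate n (0, Stay) @ [e]) (replicate n (\<lambda>_. 0) @ [w])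
      = replicate n (\<lambda>_. 0) @ [act e w]" for n
    by (induction n) (auto simp del: act.simps)
  with tr blank show ?thesis
    by (simp add: tstep_def layout_def del: act.simps)
qed

lemma scan_first:
  assumes "set x \<subseteq> {1..B}" "p \<in> P\<^sub>1" "p' \<in> P\<^sub>2" "y 0 \<le> B" "v 0 \<le> B"
  shows "reaches trans (length x)
    (Scan (p, p'), layout (tape_of l x) y (tape_of m []) v (tape_of n []))
    (Scan (mealy_state \<delta>\<^sub>1 p x, p'), layout (tape_of (rev x @ l) []) y
       (tape_of (rev (mealy_out \<delta>\<^sub>1 p x) @ m) []) v
         (tape_of (rev (if copy then x else []) @ n) []))"
  using assms(1,2)
proof (induction x arbitrary: p l m n)
  case (Cons a x)
  obtain q b where qb: "\<delta>\<^sub>1 p a = (q, b)" by fastforce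
  then have q: "q \<in> P\<^sub>1" using mealy_boundedD(1)[OF bounded(1) Cons.prems(2,1)] by simp
  have "tstep trans (Scan (p, p'), layout (tape_of l (a # x)) y (tape_of m []) v (tape_of n []))
    = (Scan (q, p'), layout (tape_of (a # l) x) y (tape_of ((if b = 0 then [] else [b]) @ m) []) v
        (tape_of ((if copy then [a] else []) @ n) []))"
    using Cons.prems assms(3-)
    by (subst tstep_layout) (auto simp: qb act_right act_emit simp del: act.simps)
  then show ?case
    using Cons.IH[OF _ q, of "a # l" "(if b = 0 then [] else [b]) @ m" "(if copy then [a] else [])
      @ n"]
      Cons.prems reaches_Suc[where \<tau> = trans and n = "length x"]
    by (auto simp: qb split: if_splits)
qed (simp add: reaches_refl)

lemma scan_second:
  assumes "set y \<subseteq> {1..B}" "p \<in> P\<^sub>1" "p' \<in> P\<^sub>2" "x 0 = 0" "u 0 \<le> B" "w 0 \<le> B"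
  shows "reaches trans (length y)
    (Scan (p, p'), layout x (tape_of l y) u (tape_of m []) w)
    (Scan (p, mealy_state \<delta>\<^sub>2 p' y), layout x (tape_of (rev y @ l) []) u
       (tape_of (rev (mealy_out \<delta>\<^sub>2 p' y) @ m) []) w)"
  using assms(1,3)
proof (induction y arbitrary: p' l m)
  case (Cons a y)
  obtain q b where qb: "\<delta>\<^sub>2 p' a = (q, b)" by fastforce
  then have q: "q \<in> P\<^sub>2" using mealy_boundedD(1)[OF bounded(2) Cons.prems(2,1)] by simp
  have "tstep trans (Scan (p, p'), layout x (tape_of l (a # y)) u (tape_of m []) w)
    = (Scan (p, q), layout x (tape_of (a # l) y) u (tape_of ((if b
      = 0 then [] else [b]) @ m) []) w)"
    using Cons.prems assms(2,4-)
    by (subst tstep_layout) (auto simp: qb act_right act_emit act_stay_blank simp del: act.simps)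
  then show ?case
    using Cons.IH[OF _ q, of "a # l" "(if b = 0 then [] else [b]) @ m"]
      Cons.prems reaches_Suc[where \<tau> = trans and n = "length y"]
    by (auto simp: qb split: if_splits)
qed (simp add: reaches_refl)

lemma tape_before_le: "set l \<subseteq> {1..B} \<Longrightarrow> tape_before l r 0 \<le> B"
  by (cases l) auto

lemma tape_before_zero: "set l \<subseteq> {1..B} \<Longrightarrow> tape_before l r 0 = 0 \<longleftrightarrow> l = []"
  by (cases l) auto

text \<open>The heads move in parallel, but the bound adds the lengths: their sum is the induction
  measure, and it drops with every step except the last. If \<open>M\<close> is to run, the last
  tape must be blank to the right of the head, as erasing cleans only the left part.\<close>

lemma rewind:
  assumes "x 0 = 0" "y 0 = 0"
    and "set l \<subseteq> {1..B}" "set m \<subseteq> {1..B}" "set n \<subseteq> {1..B}" "b \<Longrightarrow> r'' = []"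
  shows "reaches trans (Suc (length l + length m + length n))
    (Rewind b, layout x y (tape_before l r) (tape_before m r') (tape_before n r''))
    (if b then Run 0 else Done,
     layout x y (tape_of [] (rev l @ r)) (tape_of [] (rev m @ r'))
       (tape_of [] ((if b then [] else rev n) @ r'')))"
  using assms(3-)
proof (induction "length l + length m + length n" arbitrary: l m n r r' r'' rule: less_induct)
  case less
  have sym: "{x 0, y 0, tape_before l r 0, tape_before m r' 0, tape_before n r'' 0} \<subseteq> {..B}"
    using less.prems by (auto simp: tape_before_le assms)
  have nz: "0 \<notin> set l" "0 \<notin> set m" "0 \<notin> set n" using less.prems by auto
  have tl_sub: "set (tl l) \<subseteq> {1..B}" "set (tl m) \<subseteq> {1..B}" "set (tl n) \<subseteq> {1..B}"
    using less.prems by (cases l; cases m; cases n; auto)+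
  let ?c = "(Rewind b, layout x y (tape_before l r) (tape_before m r') (tape_before n r''))"
  show ?case
  proof (cases "l = [] \<and> m = [] \<and> n = []")
    case True
    have "tstep trans ?c = (if b then Run 0 else Done,
        layout x y (tape_of [] r) (tape_of [] r') (tape_of [] r''))"
      using sym True assms(1,2)
      by (subst tstep_layout) (auto simp: act_before_right act_stay_blank simp del: act.simps)
    then show ?thesis using True reaches_step by fastforce
  next
    case False
    have rev_tl: "rev (tl k) @ take (Suc 0) k @ s = rev k @ s" for k s :: "nat list"
      by (cases k) auto
    let ?r'' = "if b then [] else take 1 n @ r''"
    have w: "act (if b then erase (tape_before n r'' 0) else retreat (tape_before n r'' 0))
      (tape_before n r'')
        = tape_before (tl n) ?r''"
      using less.prems(4) nz act_retreat act_erase by auto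
    have "front (Rewind b) (x 0) (y 0) (tape_before l r 0) (tape_before m r' 0)
      (tape_before n r'' 0)
      = Some (Rewind b, (x 0, Stay), (y 0, Stay), retreat (tape_before l r 0), retreat
        (tape_before m r' 0),
          if b then erase (tape_before n r'' 0) else retreat (tape_before n r'' 0))"
      using False tape_before_zero less.prems by auto
    from tstep_layout[where x = x and y = y and u = "tape_before l r" and v = "tape_before m r'"
        and w = "tape_before n r''", OF this sym]
    have "tstep trans ?c = (Rewind b,
        layout x y (tape_before (tl l) (take 1 l @ r)) (tape_before (tl m) (take 1 m @ r'))
          (tape_before (tl n) ?r''))"
      by (simp only: act_stay act_retreat nz not_False_eq_True w)
    moreover have lt: "length (tl l) + length (tl m) + length (tl n) < length l + length m +
      length n"
      using False by (cases l; cases m; cases n) auto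
    ultimately have "reaches trans (Suc (length (tl l) + length (tl m) + length (tl n))) (tstep
      trans ?c)
      (if b then Run 0 else Done,
       layout x y (tape_of [] (rev l @ r)) (tape_of [] (rev m @ r'))
         (tape_of [] ((if b then [] else rev n) @ r'')))"
      using less.hyps[OF lt tl_sub, of ?r'' "take 1 l @ r" "take 1 m @ r'"] less.prems(4)
      by (cases b) (simp_all add: rev_tl)
    from reaches_mono[OF reaches_Suc[OF this]] lt show ?thesis
      by (simp only: Suc_le_eq Suc_less_eq less_Suc_eq_le)
  qed
qed

text \<open>Both input heads scan blanks, so \<open>M\<close> is simulated step for step without
  overhead.\<close>

lemma run_M:
  assumes "x 0 = 0" "y 0 = 0"
  shows "(tstep trans ^^ n) (Run q, x # y # ts) =
    (case (tstep (curry (table M)) ^^ n) (q, ts) of (q', ts') \<Rightarrow> (Run q', x # y # ts'))"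
proof (induction n)
  case (Suc n)
  have "tstep trans (Run q, x # y # ts) =
    (case tstep (curry (table M)) (q, ts) of (q', ts') \<Rightarrow> (Run q', x # y # ts'))" for q ts
    using assms by (auto simp: tstep_def act_stay_blank split: option.splits simp del: act.simps)
  moreover obtain q' ts' where "(tstep (curry (table M)) ^^ n) (q, ts) = (q', ts')" by fastforce
  ultimately show ?case using Suc by (simp only: funpow.simps comp_apply prod.case)
qed simp

lemma front_computes:
  assumes x: "set x \<subseteq> {1..B}" and y: "set y \<subseteq> {1..B}"
  defines "h \<equiv> mealy_out \<delta>\<^sub>1 p\<^sub>1 x" and "k \<equiv> mealy_out \<delta>\<^sub>2 p\<^sub>2 y"
    and "out' \<equiv> 1 # (if copy then x else [])"
  assumes M: "acc (mealy_state \<delta>\<^sub>1 p\<^sub>1 x) \<Longrightarrow> computes_within M T [h, k] out"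
  shows "computes_within front_tm (T + 3 * length x + 2 * length y + 4) [x, y]
    (if acc (mealy_state \<delta>\<^sub>1 p\<^sub>1 x) then out else out')"
proof -
  let ?p = "mealy_state \<delta>\<^sub>1 p\<^sub>1 x" and ?p' = "mealy_state \<delta>\<^sub>2 p\<^sub>2 y"
  let ?x = "tape_of (rev x) []" and ?y = "tape_of (rev y) []"
  have syms: "set h \<subseteq> {1..B}" "set k \<subseteq> {1..B}" "set out' \<subseteq> {1..B}"
    using mealy_out_symbols[OF bounded(1) initial(1) x] mealy_out_symbols[OF bounded(2) initial(2)
      y]
      x B_pos by (auto simp: h_def k_def out'_def)
  have le: "y' \<le> B" if "set y \<subseteq> {1..B}" "y' = tape_of [] y 0" for y' y
    using that by (cases y) auto
  \<comment> \<open>Two single steps, two scans, and a rewind that takes one step more than there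
    are symbols in \<open>h\<close>, \<open>k\<close> and \<open>out'\<close>; these have at most
    \<open>length x\<close>, \<open>length y\<close> and \<open>length x + 1\<close>
    symbols.\<close>
  define N where "N = 3 * length x + 2 * length y + 4"
  have start: "(Start, map word_tape [x, y] @ replicate (tapes M + 2 - length [x, y]) (\<lambda>_. 0))
      = (Start :: ('s \<times> 't) phase, layout (tape_of [] x) (tape_of [] y) (tape_of [] [])
        (tape_of [] []) (tape_of [] []))"
  proof -
    obtain n where "tapes M = n + 3" using tapes_M
      by (metis Suc_leI add.commute le_Suc_ex numeral_3_eq_3 numeral_2_eq_2)
    moreover have "replicate n (\<lambda>_. 0) @ [\<lambda>_. 0] = replicate (Suc n) ((\<lambda>_. 0) :: tape)"
      by (simp add: replicate_append_same)
    ultimately show ?thesis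
      by (simp add: layout_def word_tape_eq blank_tape_eq[symmetric] numeral_3_eq_3)
  qed
  let ?c0 = "(Start, layout (tape_of [] x) (tape_of [] y) (tape_of [] []) (tape_of [] [])
    (tape_of [] []))"
  let ?c1 = "(Scan (p\<^sub>1, p\<^sub>2), layout (tape_of [] x) (tape_of [] y) (tape_of [] [])
    (tape_of [] []) (tape_of [1] []))"
  let ?c2 = "(Scan (?p, p\<^sub>2), layout ?x (tape_of [] y) (tape_of (rev h) []) (tape_of [] [])
    (tape_of (rev out') []))"
  let ?c3 = "(Scan (?p, ?p'), layout ?x ?y (tape_of (rev h) []) (tape_of (rev k) [])
    (tape_of (rev out') []))"
  let ?c4 = "(Rewind (acc ?p), layout ?x ?y (tape_before (rev h) []) (tape_before (rev k) [])
    (tape_before (rev out') []))"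
  let ?c5 = "(if acc ?p then Run 0 else Done,
    layout ?x ?y (tape_of [] h) (tape_of [] k) (tape_of [] (if acc ?p then [] else out')))"
  have in1: "?p \<in> P\<^sub>1" and in2: "?p' \<in> P\<^sub>2"
    using mealy_state_in[OF bounded(1) initial(1) x] mealy_state_in[OF bounded(2) initial(2) y]
      by auto
  have "reaches trans (Suc 0) ?c0 ?c1"
    using le[OF x refl] le[OF y refl] B_pos
    by (intro reaches_step, subst tstep_layout) (auto simp: act_emit act_stay_blank simp del:
      act.simps)
  moreover have "reaches trans (length x) ?c1 ?c2"
    using scan_first[where l = "[]" and m = "[]" and n = "[1]" and y = "tape_of [] y" and v
      = "tape_of [] []",
        OF x initial] le[OF y refl] by (simp add: h_def out'_def)
  moreover have "reaches trans (length y) ?c2 ?c3"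
    using scan_second[where l = "[]" and m = "[]" and x = ?x and u = "tape_of (rev h) []" and w
      = "tape_of (rev out') []",
        OF y in1 initial(2)] by (simp add: k_def)
  moreover have "reaches trans (Suc 0) ?c3 ?c4"
    using in1 in2
    by (intro reaches_step, subst tstep_layout) (auto simp: act_left_end act_stay_blank simp del:
      act.simps)
  moreover have "reaches trans (Suc (length h + length k + length out')) ?c4 ?c5"
    using rewind[where x = ?x and y = ?y and b = "acc ?p" and l = "rev h" and m = "rev k" and n
      = "rev out'"
        and r = "[]" and r' = "[]" and r'' = "[]"] syms by (simp split: if_splits)
  ultimately have "reaches trans (Suc 0 + length x + length y + Suc 0 + Suc (length h + length k +
    length out')) ?c0 ?c5"
    by (blast intro: reaches_trans)
  moreover have "Suc 0 + length x + length y + Suc 0 + Suc (length h + length k + length out') \<le> N"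
    using length_mealy_out[of \<delta>\<^sub>1 p\<^sub>1 x] length_mealy_out[of \<delta>\<^sub>2 p\<^sub>2 y]
    by (auto simp: h_def k_def out'_def N_def)
  ultimately have front: "reaches trans N
      (Start, map word_tape [x, y] @ replicate (tapes M + 2 - length [x, y]) (\<lambda>_. 0))
      (if acc ?p then Run 0 else Done, layout ?x ?y (tape_of [] h) (tape_of [] k)
        (tape_of [] (if acc ?p then [] else out')))"
    unfolding start by (rule reaches_mono)
  show ?thesis
  proof (cases "acc ?p")
    case False
    have "computes_within front_tm (T + N) [x, y] out'"
      unfolding front_tm_def
    proof (rule computes_within_machineI[OF _ front])
      show "tape_reads (last (layout ?x ?y (tape_of [] h) (tape_of [] k)
        (tape_of [] (if acc ?p then [] else out')))) out'"
        using False syms by (auto simp: layout_def intro!: tape_reads_tape_of)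
    qed (use False tapes_M in auto)
    then show ?thesis using False by (simp add: N_def add.assoc)
  next
    case True
    obtain q ts where
      run: "reaches (curry (table M)) T
        (0, map word_tape [h, k] @ replicate (tapes M - length [h, k]) (\<lambda>_. 0)) (q, ts)"
      and halt: "table M (q, map (\<lambda>t. t 0) ts) = None" and out: "tape_reads (last ts) out"
      and len: "length ts = tapes M"
      using computes_withinE[OF M[OF True] wf_M] by metis
    \<comment> \<open>The last tape has been erased, so behind the two input tapes stand exactly the
      initial tapes of \<open>M\<close> on \<open>h\<close> and \<open>k\<close>.\<close>
    have "layout ?x ?y (tape_of [] h) (tape_of [] k) (tape_of [] [])
        = ?x # ?y # map word_tape [h, k] @ replicate (tapes M - length [h, k]) (\<lambda>_. 0)"
      using tapes_M
      by (simp add: layout_def word_tape_eq blank_tape_eq[symmetric] replicate_append_same flip: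
        replicate_Suc)
    then have "reaches trans T (Run 0, layout ?x ?y (tape_of [] h) (tape_of [] k) (tape_of [] []))
        (Run q, ?x # ?y # ts)"
      using run by (auto simp: reaches_def run_M)
    then have "reaches trans (N + T) (Start, map word_tape [x, y] @ replicate
      (tapes M + 2 - length [x, y]) (\<lambda>_. 0))
        (Run q, ?x # ?y # ts)"
      using front True by (intro reaches_trans) simp_all
    then have "computes_within front_tm (T + N) [x, y] out"
      unfolding front_tm_def
    proof (rule computes_within_machineI[rotated])
      have "ts \<noteq> []"
        using len tapes_M by auto
      then show "tape_reads (last (?x # ?y # ts)) out" using out by simp
    qed (use halt tapes_M in auto)
    then show ?thesis using True by (simp add: N_def add.assoc)
  qed
qed

end

section \<open>Block codes\<close>

text \<open>Blocks contain no blank, since a blank would end the result and \<open>emit 0\<close>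
  does not advance the head.\<close>

locale block_code =
  fixes W :: "nat \<Rightarrow> nat list" and L B :: nat
  assumes L_pos: "0 < L" and blocks: "\<And>a. a \<in> {1..B} \<Longrightarrow> length (W a) = L \<and> set (W a) \<subseteq> {1..B}"
begin

text \<open>The input head stays on a letter until its block is complete, so the state has to
  remember only the position in the block.\<close>

fun trans :: "nat phase trans" where
  "trans (Scan j) [a, b] =
     (if b \<noteq> 0 \<or> B < a \<or> L \<le> j then None
      else if a = 0 then Some (Rewind True, [(0, Stay), (0, Move_Left)])
      else if Suc j = L then Some (Scan 0, [(a, Move_Right), emit (W a ! j)])
      else Some (Scan (Suc j), [(a, Stay), emit (W a ! j)]))"
| "trans (Rewind m) [a, b] =
     (if a \<noteq> 0 \<or> B < b then None
      else if b = 0 then Some (Done, [(0, Stay), (0, Move_Right)])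
      else Some (Rewind m, [(0, Stay), retreat b]))"
| "trans _ _ = None"

lemma wf_encoder: "wf_tm (machine 2 (Scan 0) trans)"
proof (rule wf_machine)
  have "{(\<sigma>, ss). trans \<sigma> ss \<noteq> None}
      \<subseteq> ({Rewind True, Rewind False} \<union> Scan ` {..<L}) \<times> {ss. set ss \<subseteq> {..B} \<and> length ss = 2}"
  proof
    fix z assume "z \<in> {(\<sigma>, ss). trans \<sigma> ss \<noteq> None}"
    then show "z \<in> ({Rewind True, Rewind False} \<union> Scan ` {..<L}) \<times> {ss. set ss \<subseteq> {..B} \<and> length ss
      = 2}"
      by (cases z rule: trans.cases) (auto split: if_splits)
  qed
  then show "finite {(\<sigma>, ss). trans \<sigma> ss \<noteq> None}"
    by (rule finite_subset) (auto intro!: finite_cartesian_product finite_lists_length_eq)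
next
  fix \<sigma> ss \<sigma>' acts assume "trans \<sigma> ss = Some (\<sigma>', acts)"
  then show "length ss = 2 \<and> length acts = 2"
    by (cases "(\<sigma>, ss)" rule: trans.cases) (auto split: if_splits)
qed

lemma encode_letter:
  assumes "a \<in> {1..B}" "j < L"
  shows "reaches trans (L - j) (Scan j, [tape_of l (a # x), tape_of m []])
    (Scan 0, [tape_of (a # l) x, tape_of (rev (drop j (W a)) @ m) []])"
  using assms(2)
proof (induction "L - j" arbitrary: j m)
  case (Suc n)
  have W: "W a ! j \<noteq> 0" "drop j (W a) = W a ! j # drop (Suc j) (W a)"
    using blocks[OF assms(1)] Suc.prems nth_mem[of j "W a"] by (fastforce simp: Cons_nth_drop_Suc)+
  show ?case
  proof (cases "Suc j = L")
    case True
    then have "tstep trans (Scan j, [tape_of l (a # x), tape_of m []])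
        = (Scan 0, [tape_of (a # l) x, tape_of (rev (drop j (W a)) @ m) []])"
      using assms blocks[OF assms(1)] W by (simp add: tstep_def act_right act_emit del: act.simps)
    then show ?thesis using True reaches_step reaches_mono by fastforce
  next
    case False
    then have "tstep trans (Scan j, [tape_of l (a # x), tape_of m []])
        = (Scan (Suc j), [tape_of l (a # x), tape_of (W a ! j # m) []])"
      using assms Suc.prems W act_stay[of "tape_of l (a # x)"]
      by (simp add: tstep_def act_emit del: act.simps)
    moreover have "reaches trans (L - Suc j) (Scan (Suc j),
      [tape_of l (a # x), tape_of (W a ! j # m) []])
        (Scan 0, [tape_of (a # l) x, tape_of (rev (drop (Suc j) (W a)) @ W a ! j # m) []])"
      using Suc False by (intro Suc.hyps(1)) auto
    ultimately have "reaches trans (Suc (L - Suc j)) (Scan j, [tape_of l (a # x), tape_of m []])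
        (Scan 0, [tape_of (a # l) x, tape_of (rev (drop (Suc j) (W a)) @ W a ! j # m) []])"
      by (intro reaches_Suc) simp
    then show ?thesis using Suc.prems W(2) by (simp add: Suc_diff_Suc)
  qed
qed simp

lemma encode_word:
  assumes "set x \<subseteq> {1..B}"
  shows "reaches trans (L * length x) (Scan 0, [tape_of l x, tape_of m []])
    (Scan 0, [tape_of (rev x @ l) [], tape_of (rev (concat (map W x)) @ m) []])"
  using assms
proof (induction x arbitrary: l m)
  case (Cons a x)
  then have "reaches trans (L + L * length x) (Scan 0, [tape_of l (a # x), tape_of m []])
      (Scan 0, [tape_of (rev x @ a # l) [], tape_of (rev (concat (map W x)) @ rev (W a) @ m) []])"
    using encode_letter[of a 0 l x m] L_pos by (intro reaches_trans[OF _ Cons.IH]) auto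
  then show ?case by simp
qed (simp add: reaches_refl)

lemma encode_rewind:
  assumes "set l \<subseteq> {1..B}" "x 0 = 0"
  shows "reaches trans (Suc (length l)) (Rewind b, [x, tape_before l r]) (Done, [x, tape_of []
    (rev l @ r)])"
  using assms(1)
proof (induction l arbitrary: r)
  case Nil
  have "tstep trans (Rewind b, [x, tape_before [] r]) = (Done, [x, tape_of [] r])"
    using assms(2) by (simp add: tstep_def act_stay_blank act_before_right del: act.simps)
  then show ?case using reaches_step by fastforce
next
  case (Cons a l)
  then have "tstep trans (Rewind b, [x, tape_before (a # l) r])
    = (Rewind b, [x, tape_before l (a # r)])"
    using assms(2) by (simp add: tstep_def retreat_def act_stay_blank act_before_left del:
      act.simps)
  then show ?case using Cons by (simp add: reaches_Suc)
qed

text \<open>There are \<open>L * length x\<close> steps of writing and as many of rewinding, one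
  step to turn round and one to return onto the first symbol.\<close>

lemma encode_computes:
  assumes "set x \<subseteq> {1..B}"
  shows "computes_within (machine 2 (Scan 0) trans) (2 * L * length x + 2) [x] (concat (map W x))"
proof -
  let ?w = "concat (map W x)"
  have "set (W a) \<subseteq> {1..B}" if "a \<in> set x" for a using assms blocks that by blast
  then have w: "set ?w \<subseteq> {1..B}" by auto
  have "length (W a) = L" if "a \<in> set x" for a using assms blocks that by blast
  then have len: "length ?w = L * length x" by (induction x) auto
  have "tstep trans (Scan 0, [tape_of (rev x) [], tape_of (rev ?w) []])
      = (Rewind True, [tape_of (rev x) [], tape_before (rev ?w) []])"
    using L_pos by (simp add: tstep_def act_stay_blank act_left_end del: act.simps)
  with reaches_trans[OF encode_word[OF assms, of "[]" "[]"] reaches_step]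
  have "reaches trans (L * length x + Suc 0) (Scan 0, [tape_of [] x, tape_of [] []])
      (Rewind True, [tape_of (rev x) [], tape_before (rev ?w) []])" by simp
  from reaches_trans[OF this encode_rewind[where l = "rev ?w" and r = "[]"]] w
  have "reaches trans (L * length x + Suc 0 + Suc (length ?w)) (Scan 0,
    [tape_of [] x, tape_of [] []])
      (Done, [tape_of (rev x) [], tape_of [] ?w])" by simp
  then have "reaches trans (2 * L * length x + 2)
      (Scan 0, map word_tape [x] @ replicate (2 - length [x]) (\<lambda>_. 0)) (Done,
        [tape_of (rev x) [], tape_of [] ?w])"
    unfolding len by (simp add: word_tape_eq blank_tape_eq numeral_2_eq_2 algebra_simps)
  then show ?thesis
  proof (rule computes_within_machineI[rotated])
    have "0 \<notin> set ?w" using w by (meson atLeastAtMost_iff not_one_le_zero subsetD)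
    then show "tape_reads (last [tape_of (rev x) [], tape_of [] ?w]) ?w"
      by (simp add: tape_reads_tape_of)
  qed auto
qed

end

section \<open>Polynomial time\<close>

lemma poly_nat_mono: "m \<le> n \<Longrightarrow> poly p m \<le> poly (p :: nat poly) n"
  by (induction p) (auto intro: add_mono mult_mono)

lemma code_less: "a < b \<Longrightarrow> code a < code b"
proof -
  assume "a < b"
  then have "b \<in> {x. x \<le> b}" "b \<notin> {x. x \<le> a}" "{x. x \<le> a} \<subseteq> {x. x \<le> b}" by auto
  then have "{x. x \<le> a} \<subset> {x. x \<le> b}" by blast
  then show ?thesis unfolding code_def by (rule psubset_card_mono[OF finite])
qed

lemma inj_code: "inj code"
  by (rule injI) (metis code_less less_irrefl neqE)

lemma code_bounds: "code (a :: 'a::{finite,linorder}) \<in> {1..card (UNIV :: 'a set)}"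
proof -
  have "card {a} \<le> code a" unfolding code_def by (rule card_mono) auto
  moreover have "code a \<le> card (UNIV :: 'a set)" unfolding code_def by (rule card_mono) auto
  ultimately show ?thesis by simp
qed

lemma code_bool [simp]: "code False = 1" "code True = 2"
proof -
  have "{b. b \<le> False} = {False}" "{b. b \<le> True} = {False, True}" by auto
  then show "code False = 1" "code True = 2" by (simp_all add: code_def)
qed

lemma enc_symbols: "set (enc (x :: 'a::{finite,linorder} list)) \<subseteq> {1..card (UNIV :: 'a set)}"
  using code_bounds[where ?'a = 'a] by auto

lemma ptime_concat_map:
  fixes W :: "'a::{finite,linorder} \<Rightarrow> 'b::{finite,linorder} list"
  assumes "0 < L" "\<And>a. length (W a) = L"
  shows "ptime (\<lambda>x. concat (map W x))"
proof -
  let ?B = "max (card (UNIV :: 'a set)) (card (UNIV :: 'b set))"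
  \<comment> \<open>Symbols that represent no letter get a dummy block free of blanks, because the
    locale asks for a block for every symbol up to \<open>?B\<close>.\<close>
  define w where "w n = (if n \<in> range (code :: 'a \<Rightarrow> nat) then enc (W (inv code n)) else replicate
    L 1)" for n
  have w_code: "w (code a) = enc (W a)" for a :: 'a
    by (simp add: w_def inv_f_f[OF inj_code])
  interpret block_code w L ?B
  proof
    fix a
    have "1 \<le> ?B" using code_bounds[of "undefined :: 'a"] by auto
    moreover have "set (enc u) \<subseteq> {1..?B}" for u :: "'b list"
      by (rule subset_trans[OF enc_symbols]) auto
    ultimately show "length (w a) = L \<and> set (w a) \<subseteq> {1..?B}"
      using assms(2) set_replicate_conv_if[of L "1 :: nat"] by (auto simp: w_def simp del: set_map)
  qed fact
  have "computes_within (machine 2 (Scan 0) trans) (poly [:2, 2 * L:] (length x)) [enc x] (enc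
    (concat (map W x)))" for x
  proof -
    have "set (enc x) \<subseteq> {1..?B}" by (rule subset_trans[OF enc_symbols]) auto
    from encode_computes[OF this] show ?thesis
      by (simp add: map_concat comp_def w_code algebra_simps)
  qed
  then show ?thesis unfolding ptime_def using wf_encoder by blast
qed

text \<open>Transducers do not lengthen words, so by monotonicity the bound \<open>p\<close> for
  \<open>g\<close> also covers the run on the transduced inputs. The front end adds the linear term
  \<open>[:4, 3:]\<close>.\<close>

lemma ptime2_front_end:
  fixes g :: "'a::{finite,linorder} list \<Rightarrow> 'b::{finite,linorder} list \<Rightarrow> bool list"
    and h\<^sub>1 :: "bool list \<Rightarrow> 'a list" and h\<^sub>2 :: "'b list \<Rightarrow> 'b list"
    and \<delta>\<^sub>1 :: "'s::countable \<Rightarrow> nat \<Rightarrow> 's \<times> nat" and \<delta>\<^sub>2 :: "'t::countable \<Rightarrow> nat \<Rightarrow> 't \<times> nat"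
  assumes g: "ptime2 g"
    and bounded: "\<And>B. card (UNIV :: 'a set) \<le> B \<Longrightarrow> mealy_bounded B P\<^sub>1 \<delta>\<^sub>1"
      "\<And>B. mealy_bounded B P\<^sub>2 \<delta>\<^sub>2"
    and initial: "p\<^sub>1 \<in> P\<^sub>1" "p\<^sub>2 \<in> P\<^sub>2"
    and out: "\<And>x. acc (mealy_state \<delta>\<^sub>1 p\<^sub>1 (enc x)) \<Longrightarrow> mealy_out \<delta>\<^sub>1 p\<^sub>1 (enc x) = enc (h\<^sub>1 x)"
      "\<And>y. mealy_out \<delta>\<^sub>2 p\<^sub>2 (enc y) = enc (h\<^sub>2 y)"
  shows "ptime2 (\<lambda>x y. if acc (mealy_state \<delta>\<^sub>1 p\<^sub>1 (enc x)) then g (h\<^sub>1 x) (h\<^sub>2 y)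
    else False # (if copy then x else []))"
proof -
  obtain M p where wf: "wf_tm M"
    and M: "computes_within M (poly p (length x + length y)) [enc x, enc y] (enc (g x y))" for x y
    using g unfolding ptime2_def by blast
  \<comment> \<open>Room for the letters of both arguments of \<open>g\<close> and, by the summand
    2, for the bits of the word that is transduced.\<close>
  define B where "B = card (UNIV :: 'a set) + card (UNIV :: 'b set) + 2"
  interpret front_end M \<delta>\<^sub>1 \<delta>\<^sub>2 P\<^sub>1 P\<^sub>2 p\<^sub>1 p\<^sub>2 acc copy B
  proof
    show "2 < tapes M" using M[of "[]" "[]"] by (simp add: computes_within_def)
      show "mealy_bounded B P\<^sub>1 \<delta>\<^sub>1" by (rule bounded) (simp add: B_def)
  qed (simp_all add: wf bounded initial B_def)
  let ?g = "\<lambda>x y. if acc (mealy_state \<delta>\<^sub>1 p\<^sub>1 (enc x)) then g (h\<^sub>1 x) (h\<^sub>2 y)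
    else False # (if copy then x else [])"
  have "computes_within front_tm (poly (p + [:4, 3:]) (length x + length y)) [enc x, enc y] (enc
    (?g x y))" for x y
  proof -
    let ?T = "poly p (length x + length y)"
    have x: "set (enc x) \<subseteq> {1..B}" by (rule subset_trans[OF enc_symbols]) (auto simp: B_def)
    have y: "set (enc y) \<subseteq> {1..B}" by (rule subset_trans[OF enc_symbols]) (auto simp: B_def)
    have run: "computes_within M ?T [mealy_out \<delta>\<^sub>1 p\<^sub>1 (enc x), mealy_out \<delta>\<^sub>2 p\<^sub>2 (enc y)] (enc (g
      (h\<^sub>1 x) (h\<^sub>2 y)))"
      if acc: "acc (mealy_state \<delta>\<^sub>1 p\<^sub>1 (enc x))"
    proof -
      have "length (h\<^sub>1 x) + length (h\<^sub>2 y) \<le> length x + length y"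
        using length_mealy_out[of \<delta>\<^sub>1 p\<^sub>1 "enc x"] length_mealy_out[of \<delta>\<^sub>2 p\<^sub>2 "enc y"] out acc
          by simp
      from computes_within_mono[OF M poly_nat_mono[OF this]] show ?thesis by (simp add: out acc)
    qed
    have "computes_within front_tm (?T + 3 * length (enc x) + 2 * length (enc y) + 4) [enc x, enc
      y] (enc (?g x y))"
    proof -
      have "(if acc (mealy_state \<delta>\<^sub>1 p\<^sub>1 (enc x)) then enc (g (h\<^sub>1 x) (h\<^sub>2 y))
        else 1 # (if copy then enc x else [])) = enc (?g x y)" by simp
      from front_computes[OF x y run, unfolded this] show ?thesis by simp
    qed
    then show ?thesis by (rule computes_within_mono) (simp add: algebra_simps)
  qed
  then show ?thesis unfolding ptime2_def using wf_front_tm by blast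
qed

section \<open>An order-preserving block code\<close>

text \<open>A unary code padded to fixed length: the larger the letter, the earlier the ones begin,
  which makes the code monotone. The largest letter gets ones only, so no block of this length lies
  above all codes.\<close>

definition block :: "'a::{finite,linorder} \<Rightarrow> bool list" where
  "block a = replicate (card (UNIV :: 'a set) - code a) False @ replicate (code a) True"

definition encode :: "'a::{finite,linorder} list \<Rightarrow> bool list" where
  "encode x = concat (map block x)"

lemma length_block: "length (block (a :: 'a::{finite,linorder})) = card (UNIV :: 'a set)"
  using code_bounds[of a] by (simp add: block_def)

lemma length_encode: "length (encode (x :: 'a::{finite,linorder} list))
  = card (UNIV :: 'a set) * length x"
  by (induction x) (simp_all add: encode_def length_block)

section \<open>Lexicographic order on words and blocks\<close>

lemma lex_less_append:
  assumes "length u = length v"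
  shows "lex_less (u @ s) (v @ t) \<longleftrightarrow> lex_less u v \<or> u = v \<and> lex_less s t"
  using assms by (induction rule: list_induct2) (auto simp: lex_less_def)

lemma lex_less_Cons: "lex_less (a # s) (b # t) \<longleftrightarrow> a < b \<or> a = b \<and> lex_less s t"
  by (auto simp: lex_less_def)

lemma lex_less_Nil [simp]: "\<not> lex_less s []"
  by (simp add: lex_less_def)

lemma lex_less_asym: "lex_less (s :: 'a::linorder list) t \<Longrightarrow> \<not> lex_less t s"
proof (induction s arbitrary: t)
  case (Cons a s)
  then show ?case by (cases t) (auto simp: lex_less_Cons)
qed (metis lex_less_Nil)

lemma lex_less_trans: "lex_less (s :: 'a::linorder list) t \<Longrightarrow> lex_less t u \<Longrightarrow> lex_less s u"
  unfolding lex_less_def by (rule lexord_trans) (auto simp: trans_def)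

lemma block_mono:
  fixes a b :: "'a::{finite,linorder}"
  assumes "a < b"
  shows "lex_less (block a) (block b)"
proof -
  let ?c = "card (UNIV :: 'a set)"
  have le: "code a < code b" "code b \<le> ?c" using code_less[OF assms] code_bounds[of b] by auto
  \<comment> \<open>After \<open>?c - code b\<close> common zeros the block of \<open>a\<close> goes
    on with a zero and that of \<open>b\<close> with a one.\<close>
  have "?c - code a = (?c - code b) + Suc (code b - code a - 1)" using le by simp
  then have a: "block a = replicate (?c - code b) False @ False #
      (replicate (code b - code a - 1) False @ replicate (code a) True)"
    by (simp only: block_def replicate_add replicate_Suc append_assoc append_Cons)
  have "block b = replicate (?c - code b) False @ True # replicate (code b - 1) True"
    using le unfolding block_def by (cases "code b") auto
  then show ?thesis unfolding a by (simp add: lex_less_append lex_less_Cons)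
qed

section \<open>Rounding a block up to a letter\<close>

definition top_letter :: "'a::{finite,linorder}" where "top_letter = Max UNIV"
definition bot_letter :: "'a::{finite,linorder}" where "bot_letter = Min UNIV"

lemma not_lex_less_bot: "length x = n \<Longrightarrow> \<not> lex_less x (replicate n bot_letter)"
proof (induction n arbitrary: x)
  case (Suc n)
  have "\<not> a < bot_letter" for a :: 'a
    unfolding bot_letter_def not_less by (rule Min_le) auto
  then show ?case using Suc by (cases x) (auto simp: lex_less_Cons lex_less_def)
qed simp

lemma not_top_less:
  fixes c :: "bool list"
  assumes "length c = card (UNIV :: 'a::{finite,linorder} set)"
  shows "\<not> lex_less (block (top_letter :: 'a)) c"
proof -
  have "{b. b \<le> top_letter} = (UNIV :: 'a set)" by (auto simp: top_letter_def)
  then have "block (top_letter :: 'a) = replicate (length c) True"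
    by (simp add: block_def code_def assms)
  moreover have "\<not> lex_less (replicate (length c) True) c"
    by (induction c) (auto simp: lex_less_Cons)
  ultimately show ?thesis by simp
qed

definition round_up :: "bool list \<Rightarrow> 'a::{finite,linorder}" where
  "round_up c = Min {a. \<not> lex_less (block a) c}"

text \<open>By monotonicity of \<open>block\<close> the letters with block below \<open>c\<close>
  form an initial segment, and \<open>round_up c\<close> is the first letter outside it; one exists
  by \<open>not_top_less\<close>.\<close>

lemma block_less_iff:
  fixes a :: "'a::{finite,linorder}"
  assumes "length c = card (UNIV :: 'a set)"
  shows "lex_less (block a) c \<longleftrightarrow> a < round_up c"
proof -
  let ?S = "{a :: 'a. \<not> lex_less (block a) c}"
  have "?S \<noteq> {}" using not_top_less[OF assms] by blast
  then have up: "\<not> lex_less (block (round_up c :: 'a)) c" unfolding round_up_def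
    using Min_in[of ?S] by simp
  show ?thesis
  proof
    assume less: "lex_less (block a) c"
    have "\<not> round_up c < a" using up block_mono lex_less_trans[OF _ less] by blast
    moreover have "a \<noteq> round_up c" using up less by auto
    ultimately show "a < round_up c" by simp
  next
    assume "a < round_up c"
    then have "a \<notin> ?S" unfolding round_up_def by (meson Min_le finite leD)
    then show "lex_less (block a) c" by simp
  qed
qed

lemma block_eq_iff:
  fixes a :: "'a::{finite,linorder}"
  assumes "length c = card (UNIV :: 'a set)"
  shows "block a = c \<longleftrightarrow> a = round_up c \<and> block (round_up c :: 'a) = c"
proof
  assume eq: "block a = c"
  have "\<not> a < round_up c" using block_less_iff[OF assms, of a] eq lex_less_asym by blast
  moreover have "\<not> round_up c < a"
    using block_mono[of "round_up c" a] block_less_iff[OF assms, of "round_up c"] eq by auto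
  ultimately show "a = round_up c \<and> block (round_up c :: 'a) = c" using eq by auto
qed simp

section \<open>Decoding by a transducer\<close>

text \<open>
  Blocks that encode no letter are rounded up, and everything after the first of them is replaced
  by the least letter, so \<open>decode True [] y\<close> is the least word whose code is not below \<open>y\<close>. The
  flag is false once such a block has been seen, and \<open>c\<close> is the part of the current block already
  read.
\<close>

fun decode :: "bool \<Rightarrow> bool list \<Rightarrow> bool list \<Rightarrow> 'a::{finite,linorder} list" where
  "decode ok c [] = []"
| "decode ok c (b # y) = (let c' = c @ [b]; a = round_up c' in
     if length c' = card (UNIV :: 'a set)
     then (if ok then a else bot_letter) # decode (ok \<and> block a = c') [] y
     else decode ok c' y)"

text \<open>The transducer for \<open>decode\<close>: its state holds the partial block and the
  flag. The type argument fixes the target alphabet, which the tape symbols do not reveal.\<close>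

definition decode_step ::
  "'a::{finite,linorder} itself \<Rightarrow> bool list \<times> bool \<Rightarrow> nat \<Rightarrow> (bool list \<times> bool) \<times> nat"
where
  "decode_step _ p n = (let c' = fst p @ [n = code True]; a = round_up c' :: 'a in
     if length c' = card (UNIV :: 'a set)
     then (([], snd p \<and> block a = c'), code (if snd p then a else bot_letter))
     else ((c', snd p), 0))"

lemma decode_step_code:
  "decode_step TYPE('a::{finite,linorder}) p (code b) = (let c' = fst p @ [b]; a
    = round_up c' :: 'a in
     if length c' = card (UNIV :: 'a set)
     then (([], snd p \<and> block a = c'), code (if snd p then a else bot_letter))
     else ((c', snd p), 0))"
  by (cases b) (simp_all add: decode_step_def)

lemma code_nonzero: "code a \<noteq> 0"
  using code_bounds[of a] by simp

lemma mealy_out_decode: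
  "mealy_out (decode_step TYPE('a)) (c, ok) (enc y)
    = enc (decode ok c y :: 'a::{finite,linorder} list)"
  by (induction y arbitrary: c ok)
    (simp_all add: decode_step_code Let_def code_nonzero)

lemma mealy_bounded_decode:
  assumes "card (UNIV :: 'a::{finite,linorder} set) \<le> B"
  shows "mealy_bounded B ({c. length c < card (UNIV :: 'a set)} \<times> UNIV) (decode_step TYPE('a))"
proof -
  have "code a \<le> B" for a :: 'a using code_bounds[of a] assms by simp
  moreover have "finite {c :: bool list. length c < card (UNIV :: 'a set)}"
    by (rule finite_subset[OF _ finite_lists_length_le[of UNIV "card (UNIV :: 'a set)"]]) auto
  ultimately show ?thesis
    by (auto simp: mealy_bounded_def decode_step_def Let_def finite_UNIV_card_ge_0)
qed

text \<open>Splitting off the part \<open>c\<close> already read makes induction on the rest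
  \<open>d\<close> possible; \<open>d\<close> is nonempty because the letter is released with the
  last bit of its block.\<close>

lemma decode_block:
  assumes "length c + length d = card (UNIV :: 'a::{finite,linorder} set)" "d \<noteq> []"
  shows "decode ok c (d @ y) = (if ok then round_up (c @ d) else bot_letter :: 'a) #
      decode (ok \<and> block (round_up (c @ d) :: 'a) = c @ d) [] y"
    and "mealy_state (decode_step TYPE('a)) (c, ok) (enc (d @ y))
      = mealy_state (decode_step TYPE('a)) ([], ok \<and> block (round_up (c @ d) :: 'a)
        = c @ d) (enc y)"
proof -
  have "decode ok c (d @ y) = (if ok then round_up (c @ d) else bot_letter :: 'a) #
      decode (ok \<and> block (round_up (c @ d) :: 'a) = c @ d) [] y \<and>
    mealy_state (decode_step TYPE('a)) (c, ok) (enc (d @ y))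
      = mealy_state (decode_step TYPE('a)) ([], ok \<and> block (round_up (c @ d) :: 'a)
        = c @ d) (enc y)"
    using assms
  proof (induction d arbitrary: c)
    case (Cons b d)
    show ?case
    proof (cases d)
      case Nil
      then show ?thesis using Cons.prems
        by (simp add: decode_step_code Let_def)
    next
      case (Cons b' d')
      then show ?thesis using Cons.IH[of "c @ [b]"] Cons.prems
        by (simp add: decode_step_code Let_def)
    qed
  qed simp
  then show "decode ok c (d @ y) = (if ok then round_up (c @ d) else bot_letter :: 'a) #
      decode (ok \<and> block (round_up (c @ d) :: 'a) = c @ d) [] y"
    and "mealy_state (decode_step TYPE('a)) (c, ok) (enc (d @ y))
      = mealy_state (decode_step TYPE('a)) ([], ok \<and> block (round_up (c @ d) :: 'a)
        = c @ d) (enc y)"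
    by blast+
qed

lemma decode_tail:
  assumes "length c + length d < card (UNIV :: 'a::{finite,linorder} set)"
  shows "mealy_state (decode_step TYPE('a)) (c, ok) (enc d) = (c @ d, ok)"
  using assms
  by (induction d arbitrary: c) (simp_all add: decode_step_code Let_def)

lemma blocks_induct [consumes 1, case_names Nil Cons]:
  assumes "length y = L * m"
    and "P 0 []" "\<And>m c y. length c = L \<Longrightarrow> length y = L * m \<Longrightarrow> P m y \<Longrightarrow> P (Suc m) (c @ y)"
  shows "P m y"
  using assms(1)
proof (induction m arbitrary: y)
  case (Suc m)
  then have "P (Suc m) (take L y @ drop L y)" by (intro assms(3) Suc.IH) auto
  then show ?case by simp
qed (simp add: assms(2))

lemma card_UNIV_pos: "0 < card (UNIV :: 'a::finite set)"
  by (simp add: finite_UNIV_card_ge_0)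

lemma decode_Block:
  assumes "length c = card (UNIV :: 'a::{finite,linorder} set)"
  shows "decode ok [] (c @ y) = (if ok then round_up c else bot_letter :: 'a) #
      decode (ok \<and> block (round_up c :: 'a) = c) [] y"
    and "mealy_state (decode_step TYPE('a)) ([], ok) (enc (c @ y))
      = mealy_state (decode_step TYPE('a)) ([], ok \<and> block (round_up c :: 'a) = c) (enc y)"
proof -
  have "c \<noteq> []" using assms card_UNIV_pos[where ?'a = 'a] by auto
  then show "decode ok [] (c @ y) = (if ok then round_up c else bot_letter :: 'a) #
      decode (ok \<and> block (round_up c :: 'a) = c) [] y"
    and "mealy_state (decode_step TYPE('a)) ([], ok) (enc (c @ y))
      = mealy_state (decode_step TYPE('a)) ([], ok \<and> block (round_up c :: 'a) = c) (enc y)"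
    using decode_block[of "[]" c, where ?'a = 'a] assms by (simp_all del: map_append)
qed

text \<open>Each complete block empties the buffer, and an incomplete last one stays in it. The
  machine can thus test divisibility of the length by its final state.\<close>

lemma decode_state_aligned:
  fixes y :: "bool list"
  shows "fst (mealy_state (decode_step TYPE('a::{finite,linorder})) ([], ok) (enc y)) = []
    \<longleftrightarrow> card (UNIV :: 'a set) dvd length y"
proof (induction "length y" arbitrary: y ok rule: less_induct)
  case less
  let ?L = "card (UNIV :: 'a set)"
  show ?case
  proof (cases "length y < ?L")
    case True
    then have "?L dvd length y \<longleftrightarrow> y = []" by (auto dest: dvd_imp_le)
    then show ?thesis using decode_tail[of "[]" y, where ?'a = 'a] True by simp
  next
    case False
    let ?y = "drop ?L y"
    have "fst (mealy_state (decode_step TYPE('a)) ([], ok) (enc (take ?L y @ ?y))) = []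
      \<longleftrightarrow> ?L dvd length ?y"
      using False card_UNIV_pos[where ?'a = 'a]
      by (subst decode_Block) (simp, rule less.hyps, simp)
    then show ?thesis using False by (simp add: dvd_minus_self)
  qed
qed

lemma length_decode:
  assumes "length y = card (UNIV :: 'a::{finite,linorder} set) * m"
  shows "length (decode ok [] y :: 'a list) = m"
  using assms by (induction arbitrary: ok rule: blocks_induct) (simp_all add: decode_Block)

lemma decode_False:
  assumes "length y = card (UNIV :: 'a::{finite,linorder} set) * m"
  shows "decode False [] y = (replicate m bot_letter :: 'a list)"
  using assms by (induction rule: blocks_induct) (simp_all add: decode_Block)

lemma decode_state_valid:
  assumes "length y = card (UNIV :: 'a::{finite,linorder} set) * m"
  shows "snd (mealy_state (decode_step TYPE('a)) ([], ok) (enc y))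
    \<longleftrightarrow> ok \<and> encode (decode True [] y :: 'a list) = y"
  using assms
proof (induction arbitrary: ok rule: blocks_induct)
  case (Cons m c y)
  \<comment> \<open>If the first block is no code, both sides are false, whatever
    \<open>decode\<close> makes of the rest.\<close>
  have eq: "encode (decode True [] (c @ y) :: 'a list) = c @ y \<longleftrightarrow>
      block (round_up c :: 'a) = c \<and> encode (decode True [] y :: 'a list) = y"
    unfolding decode_Block(1)[OF Cons.hyps(1)]
    by (cases "block (round_up c :: 'a) = c") (simp_all add: encode_def length_block Cons.hyps(1))
  show ?case
    by (subst decode_Block(2)[OF Cons.hyps(1)], subst Cons.IH, subst eq, rule conj_assoc)
qed (simp add: encode_def)

lemma decode_encode: "decode True [] (encode x) = x"
proof (induction x)
  case (Cons a x)
  have "round_up (block a) = a" using block_eq_iff[OF length_block, of a a] by simp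
  then show ?case using Cons by (simp add: encode_def decode_Block length_block)
qed (simp add: encode_def)

lemma inj_encode: "inj encode"
  by (metis decode_encode injI)

text \<open>Rounding up is adjoint to encoding; this holds for letters by
  \<open>block_less_iff\<close> and is lifted to words block by block.\<close>

lemma encode_less_iff:
  fixes x :: "'a::{finite,linorder} list"
  assumes "length y = card (UNIV :: 'a set) * m" "length x = m"
  shows "lex_less (encode x) y \<longleftrightarrow> lex_less x (decode True [] y)"
  using assms
proof (induction arbitrary: x rule: blocks_induct)
  case (Cons m c y)
  obtain a x' where x: "x = a # x'" "length x' = m" using Cons.prems by (cases x) auto
  have "lex_less (encode x) (c @ y) \<longleftrightarrow> lex_less (block a) c \<or> block a = c \<and> lex_less (encode x') y"
    unfolding x by (simp add: encode_def lex_less_append length_block Cons.hyps)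
  also have "\<dots> \<longleftrightarrow> a < round_up c \<or> (a = round_up c \<and> block (round_up c :: 'a)
    = c) \<and> lex_less x' (decode True [] y)"
    using block_less_iff[OF Cons.hyps(1), of a] block_eq_iff[OF Cons.hyps(1), of a] Cons.IH[OF x(2)]
    by (simp only:)
  \<comment> \<open>If \<open>c\<close> is no code, the decoded word continues with least letters
    only. No word of this length lies below them, so equal first letters never give a smaller word,
    as required.\<close>
  also have "\<dots> \<longleftrightarrow> lex_less x (decode True [] (c @ y))"
    using decode_False[OF Cons.hyps(2)] not_lex_less_bot[OF x(2)]
    unfolding x decode_Block(1)[OF Cons.hyps(1)]
    by (cases "block (round_up c :: 'a) = c") (simp_all add: lex_less_Cons)
  finally show ?case .
qed simp

section \<open>Stretched witnesses\<close>

text \<open>Keeps every \<open>K\<close>-th letter; \<open>j\<close> letters of the current group have been passed already.\<close>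

fun thin :: "nat \<Rightarrow> nat \<Rightarrow> 'a list \<Rightarrow> 'a list" where
  "thin K j [] = []"
| "thin K j (a # w) = (if Suc j = K then a # thin K 0 w else thin K (Suc j) w)"

definition thin_step :: "nat \<Rightarrow> nat \<Rightarrow> nat \<Rightarrow> nat \<times> nat" where
  "thin_step K j a = (if Suc j = K then (0, a) else (Suc j, 0))"

lemma mealy_out_thin: "mealy_out (thin_step K) j (enc w) = enc (thin K j w)"
  by (induction w arbitrary: j) (simp_all add: thin_step_def code_nonzero)

lemma mealy_bounded_thin: "0 < K \<Longrightarrow> mealy_bounded B {..<K} (thin_step K)"
  by (auto simp: mealy_bounded_def thin_step_def)

text \<open>For \<open>K = 1\<close> the transducer copies its input; this case hands on the
  precision argument in \<open>ptime_real_transfer\<close>.\<close>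

lemma thin_1 [simp]: "thin (Suc 0) 0 w = w"
  by (induction w) simp_all

text \<open>Each kept letter accounts for \<open>K\<close> letters, of which \<open>j\<close>
  letters of the first group lie before \<open>w\<close>.\<close>

lemma length_thin: "j < K \<Longrightarrow> K * length (thin K j w) \<le> length w + j"
proof (induction w arbitrary: j)
  case (Cons a w)
  then show ?case using Cons.IH[of 0] Cons.IH[of "Suc j"] by (cases "Suc j = K") auto
qed simp

lemma thin_replicate: "j < K \<Longrightarrow> thin K j (replicate (K - j) a @ w) = a # thin K 0 w"
proof (induction "K - j" arbitrary: j)
  case (Suc n)
  then have *: "K - j = Suc (K - Suc j)" by simp
  show ?case
  proof (cases "Suc j = K")
    case False
    then show ?thesis using Suc by (simp add: *)
  qed (use Suc in \<open>simp add: *\<close>)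
qed simp

lemma thin_stretch: "0 < K \<Longrightarrow> thin K 0 (concat (map (replicate K) w)) = w"
proof (induction w)
  case (Cons a w)
  then show ?case using thin_replicate[of 0 K a "concat (map (replicate K) w)"] by simp
qed simp

lemma length_stretch: "length (concat (map (replicate K) w)) = K * length w"
  by (induction w) simp_all

text \<open>
  The bound on the witnesses of the encoded problem must be a polynomial in \<open>L * n\<close> with natural
  coefficients; in general this is possible only after multiplication with some \<open>K\<close>.
\<close>

lemma poly_rescale:
  fixes p :: "nat poly"
  assumes "0 < L"
  shows "\<exists>q K. 0 < K \<and> (\<forall>n. poly q (L * n) = K * poly p n)"
proof (induction p)
  case 0
  show ?case by (rule exI[of _ 0], rule exI[of _ 1]) simp
next
  case (pCons a p)
  then obtain q K where "0 < K" "\<And>n. poly q (L * n) = K * poly p n" by blast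
  \<comment> \<open>Horner step: \<open>K * L * a + L * n * (K * poly p n) = K * L * (a + n * poly p
    n)\<close>.\<close>
  then show ?case using assms
    by (intro exI[of _ "pCons (K * L * a) q"] exI[of _ "K * L"]) (simp add: algebra_simps)
qed

section \<open>Membership in NP of the encoded problem\<close>

lemma NP_encode:
  fixes D :: "'a::{finite,linorder} list set"
  assumes "D \<in> NP"
  shows "encode ` D \<in> NP"
proof -
  let ?L = "card (UNIV :: 'a set)"
  obtain V p where V: "ptime2 (\<lambda>x w. [V x w])"
    and D: "\<And>x. x \<in> D \<longleftrightarrow> (\<exists>w :: bool list. length w \<le> poly p (length x) \<and> V x w)"
    using assms unfolding NP_def by blast
  obtain q K where K: "0 < K" and q: "\<And>n. poly q (?L * n) = K * poly p n"
    using poly_rescale[OF card_UNIV_pos] by blast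
  \<comment> \<open>An empty buffer means whole blocks, a true flag that each of them encodes a
    letter.\<close>
  define valid where "valid y = (mealy_state (decode_step TYPE('a)) ([], True) (enc y)
    = ([], True))"
    for y :: "bool list"
  have valid_iff: "valid y \<longleftrightarrow> y \<in> range (encode :: 'a list \<Rightarrow> _)" for y
  proof
    assume "valid y"
    then have "?L dvd length y" using decode_state_aligned[of True y, where ?'a = 'a]
      by (simp add: valid_def)
    then obtain m where "length y = ?L * m" by blast
    with decode_state_valid[OF this, of True] \<open>valid y\<close> show "y \<in> range (encode :: 'a list \<Rightarrow> _)"
      by (metis rangeI snd_conv valid_def)
  next
    assume "y \<in> range (encode :: 'a list \<Rightarrow> _)"
    then obtain x :: "'a list" where "y = encode x" by blast
    then show "valid y"
      using decode_state_aligned[of True y, where ?'a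
        = 'a] decode_state_valid[of y "length x" True, where ?'a = 'a]
      by (simp add: valid_def length_encode decode_encode prod_eq_iff)
  qed
  define V' where "V' y w \<longleftrightarrow> valid y \<and> V (decode True [] y) (thin K 0 w)" for y w
  \<comment> \<open>With \<open>copy\<close> false the alternative output is \<open>[False]\<close>,
    so words outside the code are rejected.\<close>
  have "ptime2 (\<lambda>y w. if mealy_state (decode_step TYPE('a)) ([], True) (enc y) = ([], True)
      then [V (decode True [] y) (thin K 0 w)] else False # (if False then y else []))"
    by (rule ptime2_front_end[OF V mealy_bounded_decode mealy_bounded_thin[OF K],
          where acc = "\<lambda>s. s = ([], True)"])
      (auto simp: mealy_out_decode mealy_out_thin K card_UNIV_pos)
  then have "ptime2 (\<lambda>y w. [V' y w])"
    by (rule back_subst[of ptime2]) (auto simp: fun_eq_iff V'_def valid_def)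
  moreover have "y \<in> encode ` D \<longleftrightarrow> (\<exists>w. length w \<le> poly q (length y) \<and> V' y w)" for y
  proof
    assume "y \<in> encode ` D"
    then obtain x where x: "x \<in> D" "y = encode x" by blast
    then obtain w where "length w \<le> poly p (length x)" "V x w" using D by blast
    \<comment> \<open>Every letter is repeated \<open>K\<close> times: \<open>thin\<close> recovers
      the witness, and the new length meets the rescaled bound.\<close>
    then show "\<exists>w. length w \<le> poly q (length y) \<and> V' y w"
      using x K by (intro exI[of _ "concat (map (replicate K) w)"])
        (simp add: V'_def valid_iff length_stretch thin_stretch decode_encode length_encode q)
  next
    assume "\<exists>w. length w \<le> poly q (length y) \<and> V' y w"
    then obtain w where w: "length w \<le> poly q (length y)" "V' y w" by blast
    then obtain x :: "'a list" where x: "y = encode x" using valid_iff by (auto simp: V'_def)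
    have "K * length (thin K 0 w) \<le> length w" using length_thin[OF K, of w] by simp
    also have "\<dots> \<le> K * poly p (length x)" using w(1) x by (simp add: length_encode q)
    finally have "K * length (thin K 0 w) \<le> K * poly p (length x)" .
    then have "length (thin K 0 w) \<le> poly p (length x)" using K by simp
    then show "y \<in> encode ` D" using w(2) x D by (auto simp: V'_def decode_encode)
  qed
  ultimately show ?thesis unfolding NP_def by blast
qed

section \<open>The transferred ensemble\<close>

definition transfer :: "'a::{finite,linorder} ensemble \<Rightarrow> bool ensemble" where
  "transfer \<mu> n y = (if card (UNIV :: 'a set) dvd n then \<Sum>x | encode x
    = y. \<mu> (length x) x else 1 / 2 ^ n)"

lemma finite_length_eq [simp]: "finite {x :: 'a::finite list. length x = n \<and> P x}"
  by (rule finite_subset[OF _ finite_lists_length_eq[of UNIV n]]) auto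

text \<open>The fibres of \<open>encode\<close> partition the words \<open>x\<close>, so summing
  over \<open>y\<close> regroups the sum over \<open>x\<close>. A trivial \<open>P\<close> gives the
  total mass, and \<open>lex_less\<close> below a fixed word gives the cumulative value.\<close>

lemma sum_transfer:
  fixes \<mu> :: "'a::{finite,linorder} ensemble"
  defines "L \<equiv> card (UNIV :: 'a set)"
  shows "(\<Sum>y | length y = L * m \<and> P y. transfer \<mu> (L * m) y) = (\<Sum>x | length x
    = m \<and> P (encode x). \<mu> m x)"
proof -
  let ?S = "{x :: 'a list. length x = m \<and> P (encode x)}" and ?T = "{y. length y = L * m \<and> P y}"
  have L: "0 < L" unfolding L_def by (rule card_UNIV_pos)
  have "(\<Sum>y\<in>?T. transfer \<mu> (L * m) y) = (\<Sum>y\<in>?T. \<Sum>x | x \<in> ?S \<and> encode x = y. \<mu> m x)"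
  proof (rule sum.cong[OF refl])
    fix y assume "y \<in> ?T"
    then have "{x :: 'a list. encode x = y} = {x \<in> ?S. encode x = y}"
      using L length_encode[where ?'a = 'a] by (auto simp: L_def)
    then have "transfer \<mu> (L * m) y = (\<Sum>x\<in>{x \<in> ?S. encode x = y}. \<mu> (length x) x)"
      by (simp add: transfer_def L_def)
    also have "\<dots> = (\<Sum>x\<in>{x \<in> ?S. encode x = y}. \<mu> m x)" by (rule sum.cong) auto
    finally show "transfer \<mu> (L * m) y = (\<Sum>x | x \<in> ?S \<and> encode x = y. \<mu> m x)" by simp
  qed
  also have "\<dots> = (\<Sum>x\<in>?S. \<mu> m x)"
    by (rule sum.group) (auto simp: length_encode L_def)
  finally show ?thesis .
qed

lemma card_bool_lists: "card {y :: bool list. length y = n} = 2 ^ n"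
  using card_lists_length_eq[of "UNIV :: bool set" n] by simp

lemma spherical_transfer:
  fixes \<mu> :: "'a::{finite,linorder} ensemble"
  assumes "spherical_ensemble \<mu>"
  shows "spherical_ensemble (transfer \<mu>)"
  unfolding spherical_ensemble_def
proof (intro allI conjI impI)
  fix n and y :: "bool list"
  show "0 \<le> transfer \<mu> n y"
    using assms by (auto simp: transfer_def spherical_ensemble_def intro!: sum_nonneg)
next
  fix n
  show "(\<Sum>y | length y = n. transfer \<mu> n y) = 1"
  proof (cases "card (UNIV :: 'a set) dvd n")
    case True
    then obtain m where "n = card (UNIV :: 'a set) * m" by blast
    then show ?thesis
      using sum_transfer[where m = m and P = "\<lambda>_. True" and \<mu> = \<mu>] assms
        by (simp add: spherical_ensemble_def)
  next
    case False
    then show ?thesis by (simp add: transfer_def card_bool_lists)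
  qed
qed

lemma cumulative_transfer:
  fixes \<mu> :: "'a::{finite,linorder} ensemble"
  assumes "card (UNIV :: 'a set) dvd length y"
  shows "cumulative (transfer \<mu>) y = cumulative \<mu> (decode True [] y)"
proof -
  obtain m where m: "length y = card (UNIV :: 'a set) * m" using assms by blast
  have "{x :: 'a list. length x = m \<and> lex_less (encode x) y}
      = {x. length x = m \<and> lex_less x (decode True [] y)}"
    using encode_less_iff[OF m] by blast
  then show ?thesis
    using sum_transfer[where m = m and P = "\<lambda>z. lex_less z y" and \<mu> = \<mu>]
      by (simp add: cumulative_def m length_decode)
qed

lemma bin_frac_Cons: "bin_frac (b # u) = of_bool b + bin_frac u / 2"
proof -
  have "(\<Sum>i<length u. of_bool ((b # u) ! Suc i) / 2 ^ Suc i) = bin_frac u / (2 :: real)"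
    unfolding bin_frac_def sum_divide_distrib by (rule sum.cong) (auto simp: field_simps)
  moreover have "bin_frac (b # u) = of_bool b + (\<Sum>i<length u. of_bool ((b # u) ! Suc i) / 2 ^ Suc
    i)"
    unfolding bin_frac_def length_Cons sum.lessThan_Suc_shift by simp
  ultimately show ?thesis by (simp only:)
qed

text \<open>Read as a binary number, \<open>y\<close> counts the words below it. The
  \<open>False\<close> in front is the units digit of \<open>bin_frac\<close>, so that the first bit
  of \<open>y\<close> has weight one half.\<close>

lemma card_lex_less:
  "real (card {z. length z = length y \<and> lex_less z y}) / 2 ^ length y = bin_frac (False # y)"
proof (induction y)
  case Nil
  show ?case by (simp add: bin_frac_def)
next
  case (Cons b y)
  let ?S = "{z. length z = length y \<and> lex_less z y}"
  \<comment> \<open>If the first bit is one, all words starting with zero lie below; any other word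
    below shares the first bit.\<close>
  have "{z. length z = length (b # y) \<and> lex_less z (b # y)}
      = (if b then Cons False ` {z. length z = length y} else {}) \<union> Cons b ` ?S"
    by (auto simp: length_Suc_conv lex_less_Cons image_iff)
  moreover have "card (Cons True ` ?S \<union> Cons False ` {z. length z = length y})
    = card ?S + 2 ^ length y"
    by (subst card_Un_disjoint) (auto simp: card_image card_bool_lists intro!: finite_imageI
      finite_length_eq[where P = "\<lambda>_. True", simplified])
  ultimately have "card {z. length z = length (b # y) \<and> lex_less z (b # y)}
    = of_bool b * 2 ^ length y + card ?S"
    by (simp add: card_image Un_commute)
  then have "real (card {z. length z = length (b # y) \<and> lex_less z (b # y)}) / 2 ^ length (b # y)
      = (of_bool b + real (card ?S) / 2 ^ length y) / 2"
    by (simp add: field_simps)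
  also have "\<dots> = bin_frac (False # b # y)" unfolding Cons.IH by (simp add: bin_frac_Cons)
  finally show ?case .
qed

lemma cumulative_transfer_uniform:
  fixes \<mu> :: "'a::{finite,linorder} ensemble"
  assumes "\<not> card (UNIV :: 'a set) dvd length y"
  shows "cumulative (transfer \<mu>) y = bin_frac (False # y)"
  using card_lex_less[of y] assms by (simp add: cumulative_def transfer_def)

lemma ptime_real_transfer:
  fixes \<mu> :: "'a::{finite,linorder} ensemble"
  assumes "ptime_real (cumulative \<mu>)"
  shows "ptime_real (cumulative (transfer \<mu>))"
proof -
  obtain g :: "'a list \<Rightarrow> unit list \<Rightarrow> bool list" where g: "ptime2 g"
    and approx: "\<And>x k. \<bar>bin_frac (g x (replicate k ())) - cumulative \<mu> x\<bar> \<le> 1 / 2 ^ k"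
    using assms unfolding ptime_real_def by blast
  define g' where "g' y w = (if card (UNIV :: 'a set) dvd length y then g (decode True [] y) w
    else False # y)" for y w
  \<comment> \<open>With \<open>copy\<close> true the alternative output is
    \<open>False # y\<close>, the exact cumulative value at the uniform lengths and hence good for
    every precision.\<close>
  have "ptime2 (\<lambda>y w. if fst (mealy_state (decode_step TYPE('a)) ([], True) (enc y)) = []
      then g (decode True [] y) w else False # (if True then y else []))"
    by (rule ptime2_front_end[OF g mealy_bounded_decode mealy_bounded_thin[OF zero_less_one],
          where acc = "\<lambda>s. fst s = []"])
      (auto simp: mealy_out_decode mealy_out_thin card_UNIV_pos)
  then have "ptime2 g'"
    by (rule back_subst[of ptime2]) (auto simp: fun_eq_iff g'_def decode_state_aligned)
  moreover have "\<bar>bin_frac (g' y (replicate k ())) - cumulative (transfer \<mu>) y\<bar> \<le> 1 / 2 ^ k" for y k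
    using approx by (simp add: g'_def cumulative_transfer cumulative_transfer_uniform)
  ultimately show ?thesis unfolding ptime_real_def by blast
qed

section \<open>Assembling the reduction\<close>

theorem theorem4p10:
  fixes D :: "'a::{finite,linorder} list set" and \<mu> :: "'a ensemble"
  assumes "(D, \<mu>) \<in> DistNP"
  shows "\<exists>(E :: bool list set) (\<nu> :: bool ensemble) (f :: 'a list \<Rightarrow> bool list).
    (E, \<nu>) \<in> DistNP \<and> CS_reduction f (D, \<mu>) (E, \<nu>) \<and> (\<exists>c. \<forall>n. size_growth f n = c * n)"
proof (intro exI conjI allI)
  let ?L = "card (UNIV :: 'a set)"
  have L: "0 < ?L" by (rule card_UNIV_pos)
  show "(encode ` D, transfer \<mu>) \<in> DistNP"
    using assms NP_encode spherical_transfer ptime_real_transfer by (auto simp: DistNP_def)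
  have inv: "size_invariant (encode :: 'a list \<Rightarrow> bool list)"
    using L by (simp add: size_invariant_def length_encode)
  have "ptime (encode :: 'a list \<Rightarrow> bool list)"
    unfolding encode_def by (rule ptime_concat_map[OF L length_block])
  then have "ptime_reduction encode D (encode ` D)"
    by (auto simp: ptime_reduction_def inj_image_mem_iff[OF inj_encode])
  \<comment> \<open>A multiple of \<open>?L\<close> is the length of the code of any word with the
    right number of letters, so \<open>transfer\<close> splits the lengths as
    \<open>is_transfer\<close> demands.\<close>
  moreover have "(\<exists>z :: 'a list. length y = length (encode z))
    \<longleftrightarrow> ?L dvd length y" for y :: "bool list"
    by (metis dvd_def length_encode length_replicate)
  then have "is_transfer encode \<mu> (transfer \<mu>)"
    by (simp add: is_transfer_def transfer_def)
  ultimately show "CS_reduction encode (D, \<mu>) (encode ` D, transfer \<mu>)"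
    using inv by (simp add: CS_reduction_def)
  show "size_growth (encode :: 'a list \<Rightarrow> bool list) n = ?L * n" for n
    using size_growth_length[OF inv, of "replicate n undefined"] by (simp add: length_encode)
qed

end
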